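(* Let $P,Q\subset\mathbb{R}^3$ each be either an equiprojective polytope, a polygon, or a line segment, and assume $P+Q$ is $3$-dimensional. Then the Minkowski sum $P+Q$ is equiprojective if and only if, for each edge direction $u$ shared by $P$ and $Q$, either (i) $C_P(u)=u^\perp$ or $C_Q(u)=u^\perp$, or (ii) $C_P(u)=C_Q(u)$ or $C_P(u)=-C_Q(u)$.
   Context: A $3$-dimensional polytope $P\subset\mathbb{R}^3$ is $k$-equiprojective when its orthogonal projection onto any plane not orthogonal to a facet of $P$ is a polygon with exactly $k$ vertices; equiprojective means $k$-equiprojective for some $k$. For a polytope $P\subset\mathbb{R}^3$ (of any dimension) and a face $F$, $N_P(F)=\{u\in\mathbb{R}^3:\ u\cdot x\le u\cdot y\ \forall x\in P, y\in F\}$. For non-zero $u$, the aggregated cone $C_P(u)$ is the union of the $2$-dimensional normal cones of $P$ contained in the plane $u^\perp$. A vector $u\in\mathbb{S}^2$ is an edge direction of $P$ when its first non-zero coordinate is positive and some edge of $P$ has difference of vertices a multiple of $u$. *)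

theory Defs
  imports "HOL-Analysis.Analysis"
begin

type_synonym R3 = "real ^ 3"

definition proj_plane :: "R3 \<Rightarrow> R3 \<Rightarrow> R3" where
  "proj_plane u x = x - ((x \<bullet> u) / (u \<bullet> u)) *\<^sub>R u"

text \<open>The plane with normal u is orthogonal to the plane of the facet F
  iff u is parallel to F, i.e. u lies in the linear span of the differences of points of F.\<close>
definition plane_orth_to_facet :: "R3 \<Rightarrow> R3 set \<Rightarrow> bool" where
  "plane_orth_to_facet u F \<longleftrightarrow> u \<in> span {x - y | x y. x \<in> F \<and> y \<in> F}"

definition k_equiprojective :: "nat \<Rightarrow> R3 set \<Rightarrow> bool" where
  "k_equiprojective k P \<longleftrightarrow> polytope P \<and> aff_dim P = 3 \<and>
     (\<forall>u. u \<noteq> 0 \<and> (\<forall>F. F facet_of P \<longrightarrow> \<not> plane_orth_to_facet u F) \<longrightarrow>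
        polytope (proj_plane u ` P) \<and> aff_dim (proj_plane u ` P) = 2 \<and>
        card {v. v extreme_point_of (proj_plane u ` P)} = k)"

definition equiprojective :: "R3 set \<Rightarrow> bool" where
  "equiprojective P \<longleftrightarrow> (\<exists>k. k_equiprojective k P)"

definition minkowski_sum :: "R3 set \<Rightarrow> R3 set \<Rightarrow> R3 set" where
  "minkowski_sum P Q = {x + y | x y. x \<in> P \<and> y \<in> Q}"

definition normal_cone :: "R3 set \<Rightarrow> R3 set \<Rightarrow> R3 set" where
  "normal_cone P F = {u. \<forall>x\<in>P. \<forall>y\<in>F. u \<bullet> x \<le> u \<bullet> y}"

definition orth_plane :: "R3 \<Rightarrow> R3 set" where
  "orth_plane u = {x. u \<bullet> x = 0}"

definition aggregated_cone :: "R3 set \<Rightarrow> R3 \<Rightarrow> R3 set" where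
  "aggregated_cone P u = \<Union>{normal_cone P F | F. F face_of P \<and> F \<noteq> {} \<and>
       aff_dim (normal_cone P F) = 2 \<and> normal_cone P F \<subseteq> orth_plane u}"

definition first_nonzero_pos :: "R3 \<Rightarrow> bool" where
  "first_nonzero_pos u \<longleftrightarrow> u $ 1 > 0 \<or> (u $ 1 = 0 \<and> u $ 2 > 0) \<or>
     (u $ 1 = 0 \<and> u $ 2 = 0 \<and> u $ 3 > 0)"

definition edge_direction :: "R3 set \<Rightarrow> R3 \<Rightarrow> bool" where
  "edge_direction P u \<longleftrightarrow> norm u = 1 \<and> first_nonzero_pos u \<and>
     (\<exists>E a b. E edge_of P \<and> a extreme_point_of E \<and> b extreme_point_of E \<and> a \<noteq> b \<and>
        (\<exists>c. a - b = c *\<^sub>R u))"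

definition admissible_summand :: "R3 set \<Rightarrow> bool" where
  "admissible_summand P \<longleftrightarrow> equiprojective P \<or> (polytope P \<and> aff_dim P = 2) \<or>
     (polytope P \<and> aff_dim P = 1)"

end

theory Submission
  imports Defs
begin

text \<open>
  If \<open>w\<close> is not parallel to a facet of \<open>R\<close>, the vertices of the projection of \<open>R\<close> along \<open>w\<close> are
  equinumerous with its edges, that is, with the unit vectors \<open>d \<bottom> w\<close> that are maximised over \<open>R\<close> at
  more than one point. Such a \<open>d\<close> is normal to an edge of some direction \<open>u\<close>, hence one of the two
  unit vectors orthogonal to \<open>u\<close> and \<open>w\<close>. So the number of vertices is the sum over the edge
  directions \<open>u\<close> of \<open>g\<^sub>u(u \<times> w)\<close>, where \<open>g\<^sub>u(d) = [d \<in> C(u)] + [-d \<in> C(u)]\<close> for the aggregated cone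
  \<open>C(u)\<close>, and it is constant as soon as every \<open>g\<^sub>u\<close> is constant on generic vectors of the plane
  orthogonal to \<open>u\<close>.

  Conversely, if the number of vertices is constant, add the counts at \<open>w = u\<^sub>0 + s v\<close> and
  \<open>w = u\<^sub>0 - s v\<close> for small \<open>s\<close>. Both choices give the same term \<open>g\<^sub>u\<close> for \<open>u = u\<^sub>0\<close>, while the other
  terms jump only across a plane through \<open>u\<^sub>0\<close>, so that their contributions to the sum do not depend
  on \<open>v\<close>. Hence \<open>g\<^sub>u\<close> is constant for \<open>u = u\<^sub>0\<close>. For polygons and line segments this is immediate.

  The face of \<open>P + Q\<close> maximising \<open>d\<close> is the sum of the corresponding faces of \<open>P\<close> and \<open>Q\<close>, so the cone
  of \<open>P + Q\<close> at \<open>u\<close> is the union of those of \<open>P\<close> and \<open>Q\<close>. It remains to see when the union of two sets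
  for which \<open>g\<^sub>u\<close> is constantly 1 or 2 again has constant \<open>g\<^sub>u\<close>; each cone is the closure of its generic
  vectors, so conditions on generic vectors are equalities of cones.
\<close>

subsection \<open>Lines, planes and the cross product\<close>

lemma collinear_iff_span: "collinear S \<longleftrightarrow> (\<exists>u. \<forall>x\<in>S. \<forall>y\<in>S. x - y \<in> span {u})"
  by (simp add: collinear_def span_singleton image_iff)

lemma subset_span_singleton_imp_collinear:
  assumes "S \<subseteq> span {u}"
  shows "collinear S"
  unfolding collinear_iff_span using assms span_diff by blast

lemma span_singleton_eq:
  fixes x u :: "'a::real_vector"
  assumes "x \<in> span {u}" "x \<noteq> 0"
  shows "span {x} = span {u}"
proof -
  obtain c where "x = c *\<^sub>R u" "c \<noteq> 0"
    using assms by (auto simp: span_singleton)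
  then have "u = (1 / c) *\<^sub>R x" by simp
  then have "u \<in> span {x}" by (metis span_base span_scale insertI1)
  then show ?thesis using assms(1) by (intro span_eq[THEN iffD2]) simp
qed

lemma unit_in_span_cases:
  fixes x y :: "'a::real_normed_vector"
  assumes "x \<in> span {y}" "norm x = 1" "norm y = 1"
  shows "x = y \<or> x = - y"
proof -
  obtain c where x: "x = c *\<^sub>R y" using assms(1) by (auto simp: span_singleton)
  then have "c = 1 \<or> c = - 1" using assms by auto
  then show ?thesis using x by auto
qed

lemma finite_line_Int_span_singleton:
  fixes x z :: "'a::real_vector"
  assumes "x \<noteq> 0" "z \<notin> span {x}"
  shows "finite {t. x + t *\<^sub>R (z - x) \<in> span {b}}"
proof -
  have "s = t" if hits: "x + s *\<^sub>R (z - x) \<in> span {b}" "x + t *\<^sub>R (z - x) \<in> span {b}" for s t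
  proof (rule ccontr)
    assume "s \<noteq> t"
    have "(t - s) *\<^sub>R (z - x) \<in> span {b}"
      using span_diff[OF hits(2,1)] by (simp add: scaleR_left_diff_distrib)
    then have z_diff: "z - x \<in> span {b}"
      using \<open>s \<noteq> t\<close> span_scale[of "(t - s) *\<^sub>R (z - x)" "{b}" "1 / (t - s)"] by simp
    then have "x \<in> span {b}"
      using span_diff[OF hits(2) span_scale[OF z_diff, of t]] by simp
    then have "z \<in> span {b}" "span {x} = span {b}"
      using span_add[OF z_diff, of x] assms(1) by (simp_all add: span_singleton_eq)
    then show False using assms(2) by simp
  qed
  then have "\<exists>a. {t. x + t *\<^sub>R (z - x) \<in> span {b}} \<subseteq> {a}" by blast
  then show ?thesis using finite_subset by blast
qed

lemma mem_closure_convex_minus_lines: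
  fixes x z :: "'a::real_normed_vector"
  assumes "convex N" "finite B" "x \<in> N" "x \<noteq> 0" "z \<in> N" "z \<notin> span {x}"
  shows "x \<in> closure (N - (\<Union>b\<in>B. span {b}))" (is "x \<in> closure ?G")
proof -
  define p where "p t = x + t *\<^sub>R (z - x)" for t :: real
  have "finite (\<Union>b\<in>B. {t. p t \<in> span {b}})"
    using assms(2) finite_line_Int_span_singleton[OF assms(4,6)] by (simp add: p_def)
  then have "\<forall>\<^sub>F t in at_right (0::real). \<forall>a\<in>(\<Union>b\<in>B. {t. p t \<in> span {b}}). t \<noteq> a"
    by (intro eventually_ball_finite ballI eventually_neq_at_within)
  moreover have "\<forall>\<^sub>F t in at_right (0::real). 0 < t \<and> t < 1"
    using eventually_at_right_real[of 0 1] by simp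
  ultimately have "\<forall>\<^sub>F t in at_right 0. p t \<in> closure ?G"
  proof eventually_elim
    case (elim t)
    have "p t = (1 - t) *\<^sub>R x + t *\<^sub>R z" by (simp add: p_def algebra_simps)
    then have "p t \<in> N" using convexD_alt[OF assms(1,3,5)] elim by simp
    then have "p t \<in> ?G" using elim by blast
    then show ?case by (rule subsetD[OF closure_subset])
  qed
  moreover have "(p \<longlongrightarrow> x + 0 *\<^sub>R (z - x)) (at_right 0)"
    unfolding p_def by (intro tendsto_intros)
  ultimately show ?thesis
    using Lim_in_closed_set[OF closed_closure, of p ?G "at_right 0" x] by simp
qed

lemma closure_convex_minus_lines:
  fixes N :: "'a::real_normed_vector set"
  assumes "convex N" "\<not> collinear N" "finite B"
  shows "N \<subseteq> closure (N - (\<Union>b\<in>B. span {b}))" (is "_ \<subseteq> closure ?G")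
proof -
  have nonzero: "x \<in> closure ?G" if x: "x \<in> N" "x \<noteq> 0" for x
  proof -
    obtain z where "z \<in> N" "z \<notin> span {x}"
      using assms(2) subset_span_singleton_imp_collinear[of N x] by blast
    then show ?thesis using assms x by (intro mem_closure_convex_minus_lines)
  qed
  have "0 islimpt N" if "0 \<in> N"
    using assms(2) by (intro connected_imp_perfect convex_connected assms(1) that) auto
  then have "N \<subseteq> closure (N - {0})"
    using closure_subset[of "N - {0}"] by (auto simp: islimpt_in_closure)
  also have "\<dots> \<subseteq> closure ?G" using nonzero by (intro closure_minimal) auto
  finally show ?thesis .
qed

lemma eventually_not_orthogonal:
  fixes b u v :: "'a::real_inner"
  assumes "b \<bullet> u \<noteq> 0 \<or> b \<bullet> v \<noteq> 0"
  shows "\<forall>\<^sub>F s in at_right 0. b \<bullet> (u + s *\<^sub>R v) \<noteq> 0"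
proof -
  have "\<forall>\<^sub>F s in at_right (0::real). s \<noteq> - (b \<bullet> u) / (b \<bullet> v)"
    by (rule eventually_neq_at_within)
  then show ?thesis
  proof eventually_elim
    case (elim s)
    then show ?case
      using assms by (cases "b \<bullet> v = 0") (auto simp: inner_add_right field_simps add_eq_0_iff)
  qed
qed

lemma in_span_iff_cross3_eq_0:
  fixes x y :: R3
  assumes "y \<noteq> 0"
  shows "x \<in> span {y} \<longleftrightarrow> cross3 x y = 0"
proof -
  have "cross3 x y = 0 \<longleftrightarrow> collinear {0, y, x}" by (simp add: cross_eq_0 insert_commute)
  then show ?thesis using assms by (auto simp: collinear_lemma span_singleton)
qed

lemma orthogonal_in_span_cross3:
  fixes a b d :: R3
  assumes "d \<bullet> a = 0" "d \<bullet> b = 0" "cross3 a b \<noteq> 0"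
  shows "d \<in> span {cross3 a b}"
  using assms by (simp add: in_span_iff_cross3_eq_0 Lagrange)

lemma cross3_orthogonal_neq_0:
  fixes a b :: R3
  assumes "a \<bullet> b = 0" "a \<noteq> 0" "b \<noteq> 0"
  shows "cross3 a b \<noteq> 0"
  using assms norm_and_cross_eq_0 by blast

lemma orthogonal_plane_decomposition:
  fixes u m y :: R3
  assumes "m \<bullet> u = 0" "m \<noteq> 0" "u \<noteq> 0" "y \<bullet> u = 0"
  obtains a b where "y = a *\<^sub>R m + b *\<^sub>R cross3 u m"
proof
  let ?n = "cross3 u m"
  have n: "?n \<noteq> 0" using assms by (intro cross3_orthogonal_neq_0) (simp_all add: inner_commute)
  have "cross3 y ?n = (y \<bullet> m) *\<^sub>R u" using assms(4) by (simp add: Lagrange)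
  moreover have "cross3 ?n u = (u \<bullet> u) *\<^sub>R m"
    using assms(1) by (simp add: cross_skew[of ?n u] Lagrange inner_commute)
  ultimately have "cross3 ?n (cross3 y ?n) = ((y \<bullet> m) * (u \<bullet> u)) *\<^sub>R m"
    by (simp add: cross_mult_right)
  then have "(?n \<bullet> ?n) *\<^sub>R y = ((y \<bullet> m) * (u \<bullet> u)) *\<^sub>R m + (?n \<bullet> y) *\<^sub>R ?n"
    unfolding Lagrange[of ?n y] by (simp add: diff_eq_eq)
  then have "(1 / (?n \<bullet> ?n)) *\<^sub>R (?n \<bullet> ?n) *\<^sub>R y =
      (1 / (?n \<bullet> ?n)) *\<^sub>R (((y \<bullet> m) * (u \<bullet> u)) *\<^sub>R m + (?n \<bullet> y) *\<^sub>R ?n)"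
    by (simp only:)
  then show "y = ((y \<bullet> m) * (u \<bullet> u) / (?n \<bullet> ?n)) *\<^sub>R m + ((?n \<bullet> y) / (?n \<bullet> ?n)) *\<^sub>R ?n"
    using n by (simp add: scaleR_add_right)
qed

lemma collinear_if_orthogonal:
  fixes S :: "R3 set"
  assumes "\<And>x y. x \<in> S \<Longrightarrow> y \<in> S \<Longrightarrow> a \<bullet> x = a \<bullet> y" "\<And>x y. x \<in> S \<Longrightarrow> y \<in> S \<Longrightarrow> b \<bullet> x = b \<bullet> y"
    and "cross3 a b \<noteq> 0"
  shows "collinear S"
proof -
  have "x - y \<in> span {cross3 a b}" if "x \<in> S" "y \<in> S" for x y
    using assms(1,2)[OF that] assms(3)
    by (intro orthogonal_in_span_cross3) (simp_all add: inner_commute[of "x - y"] inner_diff_right)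
  then show ?thesis unfolding collinear_iff_span by blast
qed

lemma cross3_plane_decomposition:
  fixes u m v :: R3
  assumes "m \<bullet> u = 0" "u \<noteq> 0" "v \<bullet> m \<noteq> 0"
  obtains a b where "cross3 u v = a *\<^sub>R m + b *\<^sub>R cross3 u m" "b \<noteq> 0"
proof -
  have "m \<noteq> 0" using assms(3) by auto
  then obtain a b where ab: "cross3 u v = a *\<^sub>R m + b *\<^sub>R cross3 u m"
    using orthogonal_plane_decomposition[OF assms(1) _ assms(2), of "cross3 u v"]
    by (auto simp: dot_cross_self)
  have "cross3 u v \<bullet> cross3 u m = (u \<bullet> u) * (v \<bullet> m)"
    using assms(1) by (simp add: dot_cross inner_commute)
  then have "cross3 u v \<bullet> cross3 u m \<noteq> 0" using assms(2,3) by simp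
  then have "b \<noteq> 0" unfolding ab by (auto simp: dot_cross_self)
  with ab show ?thesis by (rule that)
qed

lemma span_differences_eq_hyperplane:
  fixes F :: "'a::euclidean_space set"
  assumes "aff_dim F = DIM('a) - 1" "F \<noteq> {}" "d \<noteq> 0" "\<And>x y. x \<in> F \<Longrightarrow> y \<in> F \<Longrightarrow> d \<bullet> x = d \<bullet> y"
  shows "span {x - y | x y. x \<in> F \<and> y \<in> F} = {x. d \<bullet> x = 0}"
proof (rule subspace_dim_equal)
  show "span {x - y | x y. x \<in> F \<and> y \<in> F} \<subseteq> {x. d \<bullet> x = 0}"
    by (intro span_minimal subspace_hyperplane) (auto simp: inner_diff_right intro: assms(4))
  obtain p where p: "p \<in> F" using assms(2) by blast
  have "dim {x. d \<bullet> x = 0} = dim ((+) (- p) ` F)"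
    using assms(1,3) aff_dim_eq_dim[of p F] p by (simp add: hull_inc dim_hyperplane)
  also have "\<dots> \<le> dim (span {x - y | x y. x \<in> F \<and> y \<in> F})"
  proof (unfold dim_span, rule dim_subset)
    have "(+) (- p) x \<in> {x - y | x y. x \<in> F \<and> y \<in> F}" if "x \<in> F" for x
      unfolding mem_Collect_eq using that p by (intro exI[of _ x] exI[of _ p]) simp
    then show "(+) (- p) ` F \<subseteq> {x - y | x y. x \<in> F \<and> y \<in> F}" by blast
  qed
  finally show "dim {x. d \<bullet> x = 0} \<le> dim (span {x - y | x y. x \<in> F \<and> y \<in> F})" .
qed (simp_all add: subspace_hyperplane)

subsection \<open>Support faces\<close>

definition support_face :: "'a::real_inner set \<Rightarrow> 'a \<Rightarrow> 'a set" where
  "support_face P d = {x \<in> P. \<forall>y\<in>P. d \<bullet> y \<le> d \<bullet> x}"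

lemma support_face_subset: "support_face P d \<subseteq> P"
  by (auto simp: support_face_def)

lemma support_face_inner_eq:
  "x \<in> support_face P d \<Longrightarrow> y \<in> support_face P d \<Longrightarrow> d \<bullet> x = d \<bullet> y"
  by (force simp: support_face_def intro: order_antisym)

lemma support_face_eqI:
  assumes "x \<in> P" "\<And>y. y \<in> P \<Longrightarrow> d \<bullet> y \<le> b" "d \<bullet> x = b"
  shows "support_face P d = P \<inter> {y. d \<bullet> y = b}"
  using assms by (auto simp: support_face_def intro: order_antisym)

lemma support_face_nonempty:
  assumes "compact P" "P \<noteq> {}"
  shows "support_face P d \<noteq> {}"
proof -
  have "continuous_on P (\<lambda>x. d \<bullet> x)" by (intro continuous_intros)
  from continuous_attains_sup[OF assms this] show ?thesis by (auto simp: support_face_def)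
qed

lemma support_face_face_of:
  fixes P :: "'a::euclidean_space set"
  assumes "convex P"
  shows "support_face P d face_of P"
proof (cases "support_face P d = {}")
  case False
  then obtain x where x: "x \<in> P" "\<And>y. y \<in> P \<Longrightarrow> d \<bullet> y \<le> d \<bullet> x" by (auto simp: support_face_def)
  have "support_face P d = P \<inter> {y. d \<bullet> y = d \<bullet> x}" by (rule support_face_eqI[OF x refl])
  also have "\<dots> face_of P" by (intro face_of_Int_supporting_hyperplane_le assms x)
  finally show ?thesis .
qed simp

lemma face_eq_support_face:
  fixes P :: "'a::euclidean_space set"
  assumes "polytope P" "F face_of P" "F \<noteq> {}"
  obtains d where "F = support_face P d"
proof -
  have "F exposed_face_of P"
    using assms exposed_face_of_polyhedron[OF polytope_imp_polyhedron[OF assms(1)]] by blast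
  then obtain d b where F: "P \<subseteq> {x. d \<bullet> x \<le> b}" "F = P \<inter> {x. d \<bullet> x = b}"
    by (auto simp: exposed_face_of_def)
  then obtain x where "x \<in> P" "d \<bullet> x = b" using assms(3) by blast
  then have "support_face P d = P \<inter> {x. d \<bullet> x = b}" using F(1) by (intro support_face_eqI) auto
  with that F(2) show ?thesis by blast
qed

lemma polytope_support_face:
  fixes P :: "'a::euclidean_space set"
  assumes "polytope P"
  shows "polytope (support_face P d)"
  by (rule face_of_polytope_polytope[OF assms support_face_face_of[OF polytope_imp_convex[OF assms]]])

lemma support_face_scaleR: "c > 0 \<Longrightarrow> support_face P (c *\<^sub>R d) = support_face P d"
  by (auto simp: support_face_def)

lemma support_face_scaleR_cases:
  assumes "c \<noteq> 0"
  shows "support_face P (c *\<^sub>R d) = support_face P d \<and> support_face P (- (c *\<^sub>R d)) = support_face P (- d) \<or>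
    support_face P (c *\<^sub>R d) = support_face P (- d) \<and> support_face P (- (c *\<^sub>R d)) = support_face P d"
proof (cases "c > 0")
  case True
  then show ?thesis using support_face_scaleR[of c P d] support_face_scaleR[of c P "- d"] by simp
next
  case False
  then show ?thesis
    using assms support_face_scaleR[of "- c" P d] support_face_scaleR[of "- c" P "- d"] by simp
qed

lemma support_face_add_const:
  assumes "\<And>x y. x \<in> P \<Longrightarrow> y \<in> P \<Longrightarrow> e \<bullet> x = e \<bullet> y"
  shows "support_face P (e + d) = support_face P d"
proof -
  have "(e + d) \<bullet> y \<le> (e + d) \<bullet> x \<longleftrightarrow> d \<bullet> y \<le> d \<bullet> x" if "x \<in> P" "y \<in> P" for x y
    using assms[OF that] by (simp add: inner_add_left)
  then show ?thesis by (auto simp: support_face_def)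
qed

lemma support_face_eq_self_iff:
  "support_face P d = P \<longleftrightarrow> (\<forall>x\<in>P. \<forall>y\<in>P. d \<bullet> x = d \<bullet> y)"
proof
  assume "support_face P d = P"
  then show "\<forall>x\<in>P. \<forall>y\<in>P. d \<bullet> x = d \<bullet> y" using support_face_inner_eq by metis
next
  assume "\<forall>x\<in>P. \<forall>y\<in>P. d \<bullet> x = d \<bullet> y"
  then have "d \<bullet> y \<le> d \<bullet> x" if "x \<in> P" "y \<in> P" for x y using that by (metis order_refl)
  then show "support_face P d = P" by (auto simp: support_face_def)
qed

lemma support_face_restrict:
  assumes "support_face P d \<subseteq> G" "G \<subseteq> P" "support_face P d \<noteq> {}"
  shows "support_face G d = support_face P d"
proof -
  obtain x where x: "x \<in> G" "x \<in> P" "\<And>y. y \<in> P \<Longrightarrow> d \<bullet> y \<le> d \<bullet> x"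
    using assms unfolding support_face_def by blast
  have "support_face P d = P \<inter> {y. d \<bullet> y = d \<bullet> x}" using x by (intro support_face_eqI) auto
  moreover have "support_face G d = G \<inter> {y. d \<bullet> y = d \<bullet> x}"
    using x assms(2) by (intro support_face_eqI) auto
  ultimately show ?thesis using assms by blast
qed

lemma supporting_functionals_eq_Inter:
  assumes "F \<subseteq> P"
  shows "{d. F \<subseteq> support_face P d} = (\<Inter>x\<in>P. \<Inter>y\<in>F. {d. (x - y) \<bullet> d \<le> 0})"
  using assms by (auto simp: support_face_def inner_diff_right inner_commute)

lemma closed_supporting_functionals: "F \<subseteq> P \<Longrightarrow> closed {d. F \<subseteq> support_face P d}"
  by (simp add: supporting_functionals_eq_Inter closed_INT closed_halfspace_le)

lemma convex_supporting_functionals: "F \<subseteq> P \<Longrightarrow> convex {d. F \<subseteq> support_face P d}"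
  by (simp add: supporting_functionals_eq_Inter convex_INT convex_halfspace_le)

lemma eventually_support_face_subset:
  fixes P :: "'a::euclidean_space set"
  assumes "polytope P"
  shows "\<forall>\<^sub>F e in nhds d. support_face P e \<subseteq> support_face P d"
proof -
  define C where "C = (\<Union>F\<in>{F. F face_of P \<and> \<not> F \<subseteq> support_face P d}. {e. F \<subseteq> support_face P e})"
  have "finite {F. F face_of P \<and> \<not> F \<subseteq> support_face P d}"
    using finite_polytope_faces[OF assms] by simp
  then have "closed C"
    unfolding C_def by (intro closed_UN ballI closed_supporting_functionals) (auto dest: face_of_imp_subset)
  moreover have "d \<in> - C" by (auto simp: C_def)
  ultimately have "\<forall>\<^sub>F e in nhds d. e \<in> - C" by (intro eventually_nhds_in_open) auto
  then show ?thesis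
  proof eventually_elim
    case (elim e)
    then show ?case using support_face_face_of[OF polytope_imp_convex[OF assms], of e] by (auto simp: C_def)
  qed
qed

lemma eventually_support_face_perturb:
  fixes P :: "'a::euclidean_space set"
  assumes "polytope P" "P \<noteq> {}"
  shows "\<forall>\<^sub>F s in at_right 0. support_face P (m + s *\<^sub>R y) = support_face (support_face P m) y"
proof -
  have "((\<lambda>s::real. m + s *\<^sub>R y) \<longlongrightarrow> m + 0 *\<^sub>R y) (at_right 0)"
    by (intro tendsto_intros)
  then have "filterlim (\<lambda>s::real. m + s *\<^sub>R y) (nhds m) (at_right 0)" by simp
  from eventually_compose_filterlim[OF eventually_support_face_subset[OF assms(1)] this]
  have "\<forall>\<^sub>F s in at_right 0. support_face P (m + s *\<^sub>R y) \<subseteq> support_face P m" .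
  moreover have "\<forall>\<^sub>F s in at_right (0::real). s > 0" by (simp add: eventually_at_right_less)
  ultimately show ?thesis
  proof eventually_elim
    case (elim s)
    have "support_face P (m + s *\<^sub>R y) = support_face (support_face P m) (m + s *\<^sub>R y)"
      using elim assms
      by (intro support_face_restrict[symmetric] support_face_subset support_face_nonempty)
        (simp_all add: polytope_imp_compact)
    also have "\<dots> = support_face (support_face P m) (s *\<^sub>R y)"
      by (intro support_face_add_const support_face_inner_eq)
    also have "\<dots> = support_face (support_face P m) y" using elim by (intro support_face_scaleR)
    finally show ?case .
  qed
qed

lemma full_dim_support_face_neq:
  fixes P :: "'a::euclidean_space set"
  assumes "aff_dim P = DIM('a)" "d \<noteq> 0"
  shows "support_face P d \<noteq> P"
proof
  assume const: "support_face P d = P"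
  have "P \<noteq> {}" using assms(1) by auto
  then obtain p where "p \<in> P" by blast
  then have "P \<subseteq> {x. d \<bullet> x = d \<bullet> p}"
    using const unfolding support_face_eq_self_iff by blast
  then have "aff_dim P \<le> aff_dim {x. d \<bullet> x = d \<bullet> p}" by (rule aff_dim_subset)
  then show False using assms by simp
qed

subsection \<open>Chords and directions\<close>

definition has_chord :: "'a::real_vector set \<Rightarrow> 'a \<Rightarrow> bool" where
  "has_chord S u \<longleftrightarrow> (\<exists>x\<in>S. \<exists>y\<in>S. x \<noteq> y \<and> x - y \<in> span {u})"

lemma has_chordI: "x \<in> S \<Longrightarrow> y \<in> S \<Longrightarrow> x \<noteq> y \<Longrightarrow> x - y \<in> span {u} \<Longrightarrow> has_chord S u"
  by (auto simp: has_chord_def)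

lemma has_chordE:
  assumes "has_chord S u"
  obtains x y where "x \<in> S" "y \<in> S" "x \<noteq> y" "x - y \<in> span {u}"
  using assms by (auto simp: has_chord_def)

lemma has_chord_mono: "has_chord S u \<Longrightarrow> S \<subseteq> T \<Longrightarrow> has_chord T u"
  by (auto simp: has_chord_def)

lemma collinear_has_chord:
  assumes "collinear S" "has_chord S u" "x \<in> S" "y \<in> S"
  shows "x - y \<in> span {u}"
proof -
  obtain a b where ab: "a \<in> S" "b \<in> S" "a \<noteq> b" "a - b \<in> span {u}"
    using assms(2) by (rule has_chordE)
  obtain e where e: "\<And>x y. x \<in> S \<Longrightarrow> y \<in> S \<Longrightarrow> x - y \<in> span {e}"
    using assms(1) unfolding collinear_iff_span by blast
  have "span {u} = span {e}"
    using span_singleton_eq[of "a - b"] ab(3,4) e[OF ab(1,2)] by (metis right_minus_eq)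
  then show ?thesis using e[OF assms(3,4)] by simp
qed

lemma has_chord_inner_eq_0:
  fixes S :: "'a::real_inner set"
  assumes "has_chord S u" "\<And>x y. x \<in> S \<Longrightarrow> y \<in> S \<Longrightarrow> d \<bullet> x = d \<bullet> y"
  shows "d \<bullet> u = 0"
proof -
  obtain x y where xy: "x \<in> S" "y \<in> S" "x \<noteq> y" "x - y \<in> span {u}"
    using assms(1) by (rule has_chordE)
  then obtain c where "x - y = c *\<^sub>R u" by (auto simp: span_singleton)
  moreover have "d \<bullet> (x - y) = 0" using assms(2)[OF xy(1,2)] by (simp add: inner_diff_right)
  ultimately show ?thesis using xy(3) by auto
qed

lemma collinear_has_chord_inner_eq:
  fixes S :: "'a::real_inner set"
  assumes "collinear S" "has_chord S u" "d \<bullet> u = 0" "x \<in> S" "y \<in> S"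
  shows "d \<bullet> x = d \<bullet> y"
proof -
  obtain c where "x - y = c *\<^sub>R u"
    using collinear_has_chord[OF assms(1,2,4,5)] by (auto simp: span_singleton)
  then have "d \<bullet> (x - y) = 0" using assms(3) by simp
  then show ?thesis by (simp add: inner_diff_right)
qed

lemma support_face_chord_orthogonal: "has_chord (support_face P d) u \<Longrightarrow> d \<bullet> u = 0"
  using has_chord_inner_eq_0 support_face_inner_eq by blast

lemma eventually_support_face_eq:
  fixes P :: "'a::euclidean_space set"
  assumes "polytope P" "P \<noteq> {}" "collinear (support_face P d)" "has_chord (support_face P d) u"
  shows "\<forall>\<^sub>F e in nhds d. e \<bullet> u = 0 \<longrightarrow> support_face P e = support_face P d"
  using eventually_support_face_subset[OF assms(1)]
proof eventually_elim
  case (elim e)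
  show ?case
  proof
    assume "e \<bullet> u = 0"
    then have "support_face (support_face P d) e = support_face P d"
      unfolding support_face_eq_self_iff using collinear_has_chord_inner_eq[OF assms(3,4)] by blast
    then show "support_face P e = support_face P d"
      using support_face_restrict[OF elim support_face_subset]
        support_face_nonempty[OF polytope_imp_compact[OF assms(1)] assms(2)] by simp
  qed
qed

lemma eventually_has_chord_eq:
  fixes P :: "'a::euclidean_space set"
  assumes "polytope P" "P \<noteq> {}" "collinear (support_face P d)"
  shows "\<forall>\<^sub>F e in nhds d. e \<bullet> u = 0 \<longrightarrow>
    has_chord (support_face P e) u = has_chord (support_face P d) u"
proof (cases "has_chord (support_face P d) u")
  case True
  from eventually_support_face_eq[OF assms True] show ?thesis by eventually_elim simp
next
  case False
  from eventually_support_face_subset[OF assms(1)] show ?thesis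
    by eventually_elim (use False has_chord_mono in blast)
qed

definition normalized :: "R3 \<Rightarrow> bool" where
  "normalized u \<longleftrightarrow> norm u = 1 \<and> first_nonzero_pos u"

lemma normalized_neq_0: "normalized u \<Longrightarrow> u \<noteq> 0"
  by (auto simp: normalized_def)

lemma first_nonzero_pos_minus: "first_nonzero_pos u \<Longrightarrow> \<not> first_nonzero_pos (- u)"
  by (auto simp: first_nonzero_pos_def)

lemma first_nonzero_pos_cases: "u \<noteq> 0 \<Longrightarrow> first_nonzero_pos u \<or> first_nonzero_pos (- u)"
  by (auto simp: first_nonzero_pos_def vec_eq_iff forall_3)

lemma first_nonzero_pos_scaleR: "c > 0 \<Longrightarrow> first_nonzero_pos (c *\<^sub>R u) \<longleftrightarrow> first_nonzero_pos u"
  by (auto simp: first_nonzero_pos_def zero_less_mult_iff)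

lemma normalized_eq:
  assumes "normalized u" "normalized v" "u \<in> span {v}"
  shows "u = v"
  using unit_in_span_cases[OF assms(3)] assms(1,2) first_nonzero_pos_minus
  by (auto simp: normalized_def)

lemma normalized_cross3_neq_0:
  assumes "normalized u" "normalized v" "u \<noteq> v"
  shows "cross3 u v \<noteq> 0"
  using normalized_eq[OF assms(1,2)] in_span_iff_cross3_eq_0[OF normalized_neq_0[OF assms(2)]] assms(3)
  by blast

lemma normalized_exists:
  assumes "x \<noteq> 0"
  obtains u where "normalized u" "x \<in> span {u}"
proof -
  define s where "s = (if first_nonzero_pos x then 1 else - 1 :: real)"
  have "first_nonzero_pos (s *\<^sub>R x)"
    using first_nonzero_pos_cases[OF assms] by (auto simp: s_def)
  then have "first_nonzero_pos ((1 / norm x) *\<^sub>R (s *\<^sub>R x))"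
    using assms by (subst first_nonzero_pos_scaleR) simp_all
  then have "normalized ((s / norm x) *\<^sub>R x)"
    using assms by (simp add: normalized_def s_def)
  moreover have "x = (norm x / s) *\<^sub>R (s / norm x) *\<^sub>R x" using assms by (simp add: s_def)
  then have "x \<in> span {(s / norm x) *\<^sub>R x}" unfolding span_singleton by blast
  ultimately show ?thesis by (rule that)
qed

lemma collinear_has_chord_unique:
  assumes "collinear S" "has_chord S u" "has_chord S v" "normalized u" "normalized v"
  shows "u = v"
proof -
  obtain x y where xy: "x \<in> S" "y \<in> S" "x \<noteq> y" "x - y \<in> span {u}"
    using assms(2) by (rule has_chordE)
  have "x - y \<in> span {v}" using assms(1,3) xy by (intro collinear_has_chord)
  then have "span {u} = span {v}"
    using span_singleton_eq[of "x - y"] xy(3,4) by (metis right_minus_eq)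
  then have "u \<in> span {v}" using span_base[of u "{u}"] by simp
  with assms(4,5) show ?thesis by (rule normalized_eq)
qed

lemma edge_direction_normalized: "edge_direction P u \<Longrightarrow> normalized u"
  by (simp add: edge_direction_def normalized_def)

lemma polytope_two_extreme_points:
  fixes F :: "'a::euclidean_space set"
  assumes "polytope F" "x \<in> F" "y \<in> F" "x \<noteq> y"
  obtains a b where "a extreme_point_of F" "b extreme_point_of F" "a \<noteq> b"
proof -
  have "\<not> {a. a extreme_point_of F} \<subseteq> {a}" for a
  proof
    assume "{a. a extreme_point_of F} \<subseteq> {a}"
    then have "convex hull {a. a extreme_point_of F} \<subseteq> {a}" by (intro hull_minimal) auto
    moreover have "F = convex hull {a. a extreme_point_of F}"
      by (intro Krein_Milman_Minkowski polytope_imp_compact polytope_imp_convex assms(1))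
    ultimately show False using assms by blast
  qed
  then show ?thesis using that by blast
qed

lemma edge_direction_iff_has_chord:
  assumes P: "polytope P"
  shows "edge_direction P u \<longleftrightarrow>
    normalized u \<and> (\<exists>d. collinear (support_face P d) \<and> has_chord (support_face P d) u)"
proof (intro iffI conjI)
  assume u: "edge_direction P u"
  then show "normalized u" by (rule edge_direction_normalized)
  obtain E a b c where E: "E edge_of P" "a extreme_point_of E" "b extreme_point_of E" "a \<noteq> b"
    "a - b = c *\<^sub>R u" using u by (auto simp: edge_direction_def)
  then have face: "E face_of P" "collinear E" by (auto simp: edge_of_def collinear_aff_dim)
  have ab: "a \<in> E" "b \<in> E" using E by (auto simp: extreme_point_of_def)
  then obtain d where "E = support_face P d" using face_eq_support_face[OF P face(1)] by blast
  moreover have "has_chord E u" using ab E(4,5) by (intro has_chordI[of a _ b]) (auto simp: span_singleton)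
  ultimately show "\<exists>d. collinear (support_face P d) \<and> has_chord (support_face P d) u"
    using face(2) by blast
next
  assume "normalized u \<and> (\<exists>d. collinear (support_face P d) \<and> has_chord (support_face P d) u)"
  then obtain d where u: "normalized u" and
    edge: "collinear (support_face P d)" "has_chord (support_face P d) u" by blast
  let ?F = "support_face P d"
  obtain x y where xy: "x \<in> ?F" "y \<in> ?F" "x \<noteq> y" using edge(2) by (rule has_chordE)
  have "aff_dim {x, y} \<le> aff_dim ?F" using xy by (intro aff_dim_subset) auto
  then have "?F edge_of P"
    using xy edge(1) support_face_face_of[OF polytope_imp_convex[OF P], of d]
    by (simp add: edge_of_def collinear_aff_dim)
  moreover obtain a b where ab: "a extreme_point_of ?F" "b extreme_point_of ?F" "a \<noteq> b"
    using polytope_two_extreme_points[OF polytope_support_face[OF P] xy] by blast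
  moreover have "a - b \<in> span {u}"
    using ab by (intro collinear_has_chord[OF edge]) (auto simp: extreme_point_of_def)
  then have "\<exists>c. a - b = c *\<^sub>R u" by (auto simp: span_singleton)
  ultimately show "edge_direction P u" using u unfolding edge_direction_def normalized_def by blast
qed

lemma finite_edge_directions:
  assumes "polytope P"
  shows "finite {u. edge_direction P u}"
proof -
  define direction_of where "direction_of F = (THE u. normalized u \<and> has_chord F u)" for F
  have "{u. edge_direction P u} \<subseteq> direction_of ` {F. F face_of P}"
  proof
    fix u assume "u \<in> {u. edge_direction P u}"
    then obtain d where u: "normalized u"
      and d: "collinear (support_face P d)" "has_chord (support_face P d) u"
      using edge_direction_iff_has_chord[OF assms] by blast
    have "direction_of (support_face P d) = u"
      unfolding direction_of_def using u d
      by (intro the_equality) (auto intro: collinear_has_chord_unique[OF d(1)])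
    then show "u \<in> direction_of ` {F. F face_of P}"
      using support_face_face_of[OF polytope_imp_convex[OF assms]] by blast
  qed
  then show ?thesis using finite_polytope_faces[OF assms] finite_subset by blast
qed

subsection \<open>Generic directions\<close>

definition generic_dir :: "'a::euclidean_space set \<Rightarrow> 'a \<Rightarrow> bool" where
  "generic_dir P d \<longleftrightarrow> d \<noteq> 0 \<and> collinear (support_face P d) \<and> collinear (support_face P (- d))"

definition generic_normals :: "R3 set \<Rightarrow> R3 \<Rightarrow> R3 set" where
  "generic_normals P u = {d \<in> orth_plane u. generic_dir P d}"

lemma mem_generic_normals: "d \<in> generic_normals P u \<longleftrightarrow> d \<bullet> u = 0 \<and> generic_dir P d"
  by (auto simp: generic_normals_def orth_plane_def inner_commute)

lemma generic_dir_minus_iff: "generic_dir P (- d) \<longleftrightarrow> generic_dir P d"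
  by (auto simp: generic_dir_def)

lemma generic_dir_scaleR: "generic_dir P d \<Longrightarrow> c \<noteq> 0 \<Longrightarrow> generic_dir P (c *\<^sub>R d)"
  using support_face_scaleR_cases[of c P d] by (auto simp: generic_dir_def)

lemma minus_mem_generic_normals: "d \<in> generic_normals P u \<Longrightarrow> - d \<in> generic_normals P u"
  by (simp add: mem_generic_normals generic_dir_minus_iff)

lemma support_face_normals_in_line:
  fixes P F :: "R3 set"
  assumes "\<not> collinear F"
  shows "\<exists>b. \<forall>d. support_face P d = F \<longrightarrow> d \<in> span {b}"
proof (cases "\<exists>b. b \<noteq> 0 \<and> support_face P b = F")
  case True
  then obtain b where b: "b \<noteq> 0" "support_face P b = F" by blast
  have "d \<in> span {b}" if d: "support_face P d = F" for d
    unfolding in_span_iff_cross3_eq_0[OF b(1)]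
  proof (rule ccontr)
    assume "cross3 d b \<noteq> 0"
    then have "collinear F" using d b(2)
      by (intro collinear_if_orthogonal[of F d b]) (auto intro: support_face_inner_eq)
    then show False using assms by simp
  qed
  then show ?thesis by blast
next
  case False
  then have "\<forall>d. support_face P d = F \<longrightarrow> d \<in> span {0}" by auto
  then show ?thesis ..
qed

lemma nongeneric_subset_lines:
  fixes P :: "R3 set"
  assumes "polytope P"
  obtains B where "finite B" "{d. \<not> generic_dir P d} \<subseteq> (\<Union>b\<in>B. span {b})"
proof -
  obtain normal where
    normal: "\<not> collinear F \<Longrightarrow> support_face P d = F \<Longrightarrow> d \<in> span {normal F}" for F d
    using support_face_normals_in_line[of _ P] by metis
  show ?thesis
  proof
    let ?B = "insert 0 (normal ` {F. F face_of P})"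
    show "finite ?B" using finite_polytope_faces[OF assms] by simp
    have "support_face P e face_of P" for e
      by (intro support_face_face_of polytope_imp_convex assms)
    then have normal_in: "normal (support_face P e) \<in> ?B" for e by blast
    have "d = 0 \<or> d \<in> span {normal (support_face P d)} \<or> d \<in> span {normal (support_face P (- d))}"
      if "\<not> generic_dir P d" for d
      using that normal[OF _ refl, of d] span_neg[OF normal[OF _ refl, of "- d"]]
      by (auto simp: generic_dir_def)
    then show "{d. \<not> generic_dir P d} \<subseteq> (\<Union>b\<in>?B. span {b})" using normal_in by fastforce
  qed
qed

lemma nongeneric_eq_lines:
  fixes P :: "R3 set"
  assumes "polytope P"
  obtains B where "finite B" "{d. \<not> generic_dir P d} = (\<Union>b\<in>B. span {b})"
proof -
  obtain B where B: "finite B" "{d. \<not> generic_dir P d} \<subseteq> (\<Union>b\<in>B. span {b})"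
    using nongeneric_subset_lines[OF assms] .
  show ?thesis
  proof
    let ?B = "insert 0 {b \<in> B. \<not> generic_dir P b}"
    show "finite ?B" using B(1) by simp
    show "{d. \<not> generic_dir P d} = (\<Union>b\<in>?B. span {b})"
    proof (intro equalityI subsetI; unfold mem_Collect_eq)
      fix d assume d: "\<not> generic_dir P d"
      show "d \<in> (\<Union>b\<in>?B. span {b})"
      proof (cases "d = 0")
        case False
        have "d \<in> (\<Union>b\<in>B. span {b})" using d B(2) by blast
        then obtain b c where b: "b \<in> B" "d = c *\<^sub>R b" by (auto simp: span_singleton)
        then have "\<not> generic_dir P b" using d False generic_dir_scaleR[of P b c] by auto
        then show ?thesis using b by (auto simp: span_singleton)
      qed simp
    next
      fix d assume "d \<in> (\<Union>b\<in>?B. span {b})"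
      then obtain b where b: "b \<in> ?B" "d \<in> span {b}" by (elim UN_E)
      then obtain c where d: "d = c *\<^sub>R b" by (auto simp: span_singleton)
      show "\<not> generic_dir P d"
      proof
        assume generic: "generic_dir P d"
        then have "c \<noteq> 0" "b \<noteq> 0" using d by (auto simp: generic_dir_def)
        then show False using b(1) d generic_dir_scaleR[OF generic, of "1 / c"] by simp
      qed
    qed
  qed
qed

lemma subset_closure_generic_minus_lines:
  fixes R :: "R3 set"
  assumes "polytope R" "convex N" "\<not> collinear N" "finite B"
  shows "N \<subseteq> closure ({d \<in> N. generic_dir R d} - (\<Union>b\<in>B. span {b}))"
proof -
  obtain L where lines: "finite L" "{d. \<not> generic_dir R d} = (\<Union>b\<in>L. span {b})"
    using nongeneric_eq_lines[OF assms(1)] .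
  have "N \<subseteq> closure (N - (\<Union>b\<in>L \<union> B. span {b}))"
    using assms lines(1) by (intro closure_convex_minus_lines) auto
  also have "N - (\<Union>b\<in>L \<union> B. span {b}) = {d \<in> N. generic_dir R d} - (\<Union>b\<in>B. span {b})"
    using lines(2) by blast
  finally show ?thesis .
qed

lemma closed_orth_plane: "closed (orth_plane u)"
  unfolding orth_plane_def by (rule closed_hyperplane)

lemma convex_orth_plane: "convex (orth_plane u)"
  unfolding orth_plane_def by (rule convex_hyperplane)

lemma aff_dim_orth_plane: "u \<noteq> 0 \<Longrightarrow> aff_dim (orth_plane u) = 2"
  unfolding orth_plane_def by simp

lemma orth_plane_subset_closure:
  assumes "polytope R" "u \<noteq> 0" "finite B"
  shows "orth_plane u \<subseteq> closure (generic_normals R u - (\<Union>b\<in>B. span {b}))"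
  unfolding generic_normals_def using assms
  by (intro subset_closure_generic_minus_lines convex_orth_plane)
    (simp_all add: collinear_aff_dim aff_dim_orth_plane)

subsection \<open>Orthogonal projection along a vector\<close>

lemma linear_proj_plane: "linear (proj_plane w)"
  unfolding proj_plane_def
  by (rule linearI) (simp_all add: algebra_simps inner_add_left add_divide_distrib)

lemma proj_plane_orthogonal: "proj_plane w x \<bullet> w = 0"
  by (cases "w = 0") (simp_all add: proj_plane_def inner_diff_left)

lemma inner_proj_plane: "d \<bullet> w = 0 \<Longrightarrow> d \<bullet> proj_plane w x = d \<bullet> x"
  by (simp add: proj_plane_def inner_diff_right)

lemma support_face_proj_plane:
  assumes "d \<bullet> w = 0"
  shows "support_face (proj_plane w ` R) d = proj_plane w ` support_face R d"
  unfolding support_face_def using inner_proj_plane[OF assms] by auto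

lemma aff_dim_proj_plane:
  assumes "aff_dim R = 3" "w \<noteq> 0"
  shows "aff_dim (proj_plane w ` R) = 2"
proof -
  let ?K = "proj_plane w ` R"
  have "?K \<subseteq> {x. w \<bullet> x = 0}" using proj_plane_orthogonal by (auto simp: inner_commute)
  then have "aff_dim ?K \<le> aff_dim {x. w \<bullet> x = 0}" by (rule aff_dim_subset)
  then have upper: "aff_dim ?K \<le> 2" using assms(2) by simp
  have "R \<noteq> {}" using assms(1) by auto
  then obtain p where p: "p \<in> ?K" by blast
  let ?H = "affine hull (insert (p + w) ?K)"
  have "R \<subseteq> ?H"
  proof
    fix x assume "x \<in> R"
    then have "proj_plane w x \<in> ?H" by (auto intro: hull_inc)
    then have "proj_plane w x + (x \<bullet> w / (w \<bullet> w)) *\<^sub>R ((p + w) - p) \<in> ?H"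
      by (rule mem_affine_3_minus[OF affine_affine_hull]) (use p in \<open>auto intro: hull_inc\<close>)
    then show "x \<in> ?H" by (simp add: proj_plane_def)
  qed
  then have "aff_dim R \<le> aff_dim ?H" by (rule aff_dim_subset)
  then have "3 \<le> aff_dim (insert (p + w) ?K)" using assms(1) by simp
  also have "\<dots> \<le> aff_dim ?K + 1" by (simp add: aff_dim_insert)
  finally show ?thesis using upper by simp
qed

subsection \<open>Vertices and edges of a polygon\<close>

definition edge_normals :: "R3 set \<Rightarrow> R3 \<Rightarrow> R3 set" where
  "edge_normals K w = {d. norm d = 1 \<and> d \<bullet> w = 0 \<and>
     (\<exists>x\<in>support_face K d. \<exists>y\<in>support_face K d. x \<noteq> y)}"

lemma finite_max_ratio:
  fixes a b :: "'a \<Rightarrow> real"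
  assumes "finite V" "V \<noteq> {}" "\<And>x. x \<in> V \<Longrightarrow> a x > 0"
  obtains c x where "x \<in> V" "b x = c * a x" "\<And>y. y \<in> V \<Longrightarrow> b y \<le> c * a y"
proof -
  define c where "c = Max ((\<lambda>x. b x / a x) ` V)"
  have "c \<in> (\<lambda>x. b x / a x) ` V"
    unfolding c_def using assms(1,2) by (intro Max_in) auto
  then obtain x where "x \<in> V" "b x = c * a x" using assms(3) by force
  moreover have "b y \<le> c * a y" if "y \<in> V" for y
  proof -
    have "b y / a y \<le> c" unfolding c_def using assms(1) that by (intro Max_ge) auto
    then show ?thesis using assms(3)[OF that] by (simp add: pos_divide_le_eq)
  qed
  ultimately show ?thesis by (rule that)
qed

lemma rotate_supporting_line:
  fixes e v w :: R3
  assumes "finite V" "V \<noteq> {}" "w \<noteq> 0" "e \<bullet> w = 0" "\<And>x. x \<in> V \<Longrightarrow> e \<bullet> x < e \<bullet> v"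
  obtains d x where "d \<bullet> w = 0" "\<And>y. y \<in> V \<Longrightarrow> d \<bullet> y \<le> d \<bullet> v" "x \<in> V" "d \<bullet> x = d \<bullet> v"
    "\<And>y. y \<in> V \<Longrightarrow> d \<bullet> y = d \<bullet> v \<Longrightarrow> cross3 w d \<bullet> y < cross3 w d \<bullet> v"
proof -
  define a where "a x = e \<bullet> (v - x)" for x
  define b where "b x = cross3 w e \<bullet> (v - x)" for x
  have a_pos: "a x > 0" if "x \<in> V" for x using assms(5)[OF that] by (simp add: a_def inner_diff_right)
  \<comment> \<open>As \<open>c\<close> decreases from infinity, \<open>c e - w \<times> e\<close> turns away from the direction of \<open>e\<close>, and the
    line through \<open>v\<close> with this normal first meets another point of \<open>V\<close> at the maximal ratio.\<close>
  obtain c x where x: "x \<in> V" "b x = c * a x" and ratio_le: "\<And>y. y \<in> V \<Longrightarrow> b y \<le> c * a y"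
    using finite_max_ratio[of V a b, OF assms(1,2) a_pos] by blast
  define d where "d = c *\<^sub>R e - cross3 w e"
  have d_diff: "d \<bullet> y - d \<bullet> v = b y - c * a y" for y
    by (simp add: d_def a_def b_def inner_diff_left inner_diff_right algebra_simps)
  have cross_wd: "cross3 w d = c *\<^sub>R cross3 w e + (w \<bullet> w) *\<^sub>R e"
    using assms(4) by (simp add: d_def Cross3.right_diff_distrib Lagrange cross_mult_right inner_commute)
  show ?thesis
  proof
    show "d \<bullet> w = 0" by (simp add: d_def inner_diff_left assms(4) dot_cross_self)
    show "d \<bullet> y \<le> d \<bullet> v" if "y \<in> V" for y using ratio_le[OF that] d_diff[of y] by simp
    show "d \<bullet> x = d \<bullet> v" using x(2) d_diff[of x] by simp
    show "cross3 w d \<bullet> y < cross3 w d \<bullet> v" if "y \<in> V" "d \<bullet> y = d \<bullet> v" for y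
    proof -
      have "cross3 w d \<bullet> v - cross3 w d \<bullet> y = c * b y + (w \<bullet> w) * a y"
        by (simp add: cross_wd a_def b_def inner_add_left inner_diff_right algebra_simps)
      also have "b y = c * a y" using d_diff[of y] that(2) by simp
      finally have "cross3 w d \<bullet> v - cross3 w d \<bullet> y = (c\<^sup>2 + w \<bullet> w) * a y"
        by (simp add: algebra_simps power2_eq_square)
      moreover have "(c\<^sup>2 + w \<bullet> w) * a y > 0"
        using a_pos[OF that(1)] assms(3) by (intro mult_pos_pos add_nonneg_pos) auto
      ultimately show ?thesis by simp
    qed
  qed (rule x(1))
qed

locale planar_polygon =
  fixes K :: "R3 set" and w :: R3
  assumes polytope: "polytope K"
    and aff_dim: "aff_dim K = 2"
    and normal_neq_0: "w \<noteq> 0"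
    and normal_const: "x \<in> K \<Longrightarrow> y \<in> K \<Longrightarrow> w \<bullet> x = w \<bullet> y"
begin

text \<open>Edges and vertices are matched by sending an edge with outer normal \<open>d\<close> to its end point in the
  direction \<open>w \<times> d\<close>.\<close>

definition edge_end :: "R3 \<Rightarrow> R3" where
  "edge_end d = (THE v. support_face (support_face K d) (cross3 w d) = {v})"

lemma nonempty: "K \<noteq> {}"
  using aff_dim by auto

lemma cross3_normal_neq_0: "d \<noteq> 0 \<Longrightarrow> d \<bullet> w = 0 \<Longrightarrow> cross3 w d \<noteq> 0"
  using normal_neq_0 by (intro cross3_orthogonal_neq_0) (simp_all add: inner_commute)

lemma support_face_neq:
  assumes "d \<noteq> 0" "d \<bullet> w = 0"
  shows "support_face K d \<noteq> K"
proof
  assume "support_face K d = K"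
  then have d_const: "d \<bullet> x = d \<bullet> y" if "x \<in> K" "y \<in> K" for x y
    using that unfolding support_face_eq_self_iff by blast
  have "collinear K"
    by (rule collinear_if_orthogonal[OF normal_const d_const cross3_normal_neq_0[OF assms]])
  then show False using aff_dim by (simp add: collinear_aff_dim)
qed

lemma support_face_diff_in_span:
  assumes "d \<noteq> 0" "d \<bullet> w = 0" "x \<in> support_face K d" "y \<in> support_face K d"
  shows "x - y \<in> span {cross3 w d}"
proof (rule orthogonal_in_span_cross3)
  have "x \<in> K" "y \<in> K" using assms(3,4) support_face_subset by blast+
  then show "(x - y) \<bullet> w = 0"
    using normal_const[of x y] by (simp add: inner_diff_right inner_commute[of _ w])
  show "(x - y) \<bullet> d = 0"
    using support_face_inner_eq[OF assms(3,4)] by (simp add: inner_diff_right inner_commute[of _ d])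
qed (rule cross3_normal_neq_0[OF assms(1,2)])

lemma support_face_edge_end:
  assumes "d \<noteq> 0" "d \<bullet> w = 0"
  shows "support_face (support_face K d) (cross3 w d) = {edge_end d}"
proof -
  let ?E = "support_face (support_face K d) (cross3 w d)"
  have "?E \<noteq> {}"
    by (intro support_face_nonempty polytope_imp_compact polytope_support_face polytope nonempty)
  moreover have "x = y" if "x \<in> ?E" "y \<in> ?E" for x y
  proof -
    have "x - y \<in> span {cross3 w d}"
      using that support_face_subset by (intro support_face_diff_in_span assms) blast+
    then obtain c where c: "x - y = c *\<^sub>R cross3 w d" by (auto simp: span_singleton)
    have "cross3 w d \<bullet> (x - y) = 0"
      using support_face_inner_eq[OF that] by (simp add: inner_diff_right)
    then show ?thesis using c cross3_normal_neq_0[OF assms] by simp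
  qed
  ultimately have "\<exists>!v. ?E = {v}" by blast
  then show ?thesis unfolding edge_end_def by (rule theI')
qed

lemma edge_end_in_support_face: "d \<noteq> 0 \<Longrightarrow> d \<bullet> w = 0 \<Longrightarrow> edge_end d \<in> support_face K d"
  using support_face_edge_end support_face_subset by blast

lemma edge_end_extreme_point:
  assumes "d \<noteq> 0" "d \<bullet> w = 0"
  shows "edge_end d extreme_point_of K"
proof -
  have "{edge_end d} face_of support_face K d"
    unfolding support_face_edge_end[OF assms, symmetric]
    by (intro support_face_face_of polytope_imp_convex polytope_support_face polytope)
  then have "{edge_end d} face_of K"
    using face_of_trans support_face_face_of polytope_imp_convex[OF polytope] by blast
  then show ?thesis by (simp add: face_of_singleton)
qed

lemma edge_end_eqI:
  assumes "d \<noteq> 0" "d \<bullet> w = 0" "v \<in> support_face K d"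
    and less: "\<And>y. y extreme_point_of K \<Longrightarrow> y \<noteq> v \<Longrightarrow> d \<bullet> y = d \<bullet> v \<Longrightarrow> cross3 w d \<bullet> y < cross3 w d \<bullet> v"
  shows "edge_end d = v"
proof (rule ccontr)
  assume "edge_end d \<noteq> v"
  moreover have "d \<bullet> edge_end d = d \<bullet> v"
    using edge_end_in_support_face[OF assms(1,2)] assms(3) by (rule support_face_inner_eq)
  ultimately have "cross3 w d \<bullet> edge_end d < cross3 w d \<bullet> v"
    by (intro less edge_end_extreme_point assms)
  moreover have "cross3 w d \<bullet> v \<le> cross3 w d \<bullet> edge_end d"
    using support_face_edge_end[OF assms(1,2)] assms(3)
    unfolding support_face_def[of "support_face K d"] by blast
  ultimately show False by simp
qed

lemma edge_end_scaleR:
  assumes "c > 0"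
  shows "edge_end (c *\<^sub>R d) = edge_end d"
  unfolding edge_end_def cross_mult_right support_face_scaleR[OF assms] ..

lemma edge_end_side:
  assumes d: "d \<in> edge_normals K w" and end_d: "edge_end d \<in> support_face K e"
  shows "e \<bullet> cross3 w d \<ge> 0"
proof -
  let ?n = "cross3 w d"
  have dw: "d \<noteq> 0" "d \<bullet> w = 0" using d by (auto simp: edge_normals_def)
  obtain x where x: "x \<in> support_face K d" "x \<noteq> edge_end d"
    using d unfolding edge_normals_def by blast
  obtain t where t: "edge_end d - x = t *\<^sub>R ?n"
    using support_face_diff_in_span[OF dw edge_end_in_support_face[OF dw] x(1)]
    by (auto simp: span_singleton)
  have "?n \<bullet> x \<le> ?n \<bullet> edge_end d"
    using support_face_edge_end[OF dw] x(1) unfolding support_face_def[of "support_face K d"] by blast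
  then have "0 \<le> t * (?n \<bullet> ?n)"
    using t by (metis diff_ge_0_iff_ge inner_diff_right inner_scaleR_right)
  moreover have "t \<noteq> 0" "?n \<bullet> ?n > 0" using t x(2) cross3_normal_neq_0[OF dw] by auto
  ultimately have "t > 0" by (auto simp: zero_le_mult_iff)
  have "e \<bullet> x \<le> e \<bullet> edge_end d"
    using end_d x support_face_subset by (auto simp: support_face_def)
  then have "0 \<le> t * (e \<bullet> ?n)"
    using t by (metis diff_ge_0_iff_ge inner_diff_right inner_scaleR_right)
  then show ?thesis using \<open>t > 0\<close> by (simp add: zero_le_mult_iff)
qed

lemma inj_on_edge_end: "inj_on edge_end (edge_normals K w)"
proof (rule inj_onI)
  fix d e assume d: "d \<in> edge_normals K w" and e: "e \<in> edge_normals K w"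
    and end_eq: "edge_end d = edge_end e"
  have dw: "norm d = 1" "d \<noteq> 0" "d \<bullet> w = 0" and ew: "norm e = 1" "e \<noteq> 0" "e \<bullet> w = 0"
    using d e by (auto simp: edge_normals_def)
  have end_in: "edge_end d \<in> support_face K d" "edge_end d \<in> support_face K e"
    using edge_end_in_support_face[OF dw(2,3)] edge_end_in_support_face[OF ew(2,3)] end_eq by simp_all
  have "e \<bullet> cross3 w d \<ge> 0" "d \<bullet> cross3 w e \<ge> 0"
    using edge_end_side[OF d] edge_end_side[OF e] end_in end_eq by simp_all
  moreover have "d \<bullet> cross3 w e = - (e \<bullet> cross3 w d)" by (simp add: cross3_simps)
  ultimately have "e \<bullet> cross3 w d = 0" by linarith
  then have "cross3 w (cross3 e d) = 0" using dw ew by (simp add: Lagrange inner_commute)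
  moreover have "w \<bullet> cross3 e d = 0" using \<open>e \<bullet> cross3 w d = 0\<close> by (simp add: cross3_simps)
  ultimately have "cross3 e d = 0" using norm_and_cross_eq_0 normal_neq_0 by blast
  then have "e \<in> span {d}" using dw(2) by (simp add: in_span_iff_cross3_eq_0)
  then have "e = d \<or> e = - d" using unit_in_span_cases dw(1) ew(1) by blast
  moreover have "e \<noteq> - d"
  proof
    assume "e = - d"
    then have "d \<bullet> x = d \<bullet> edge_end d" if "x \<in> K" for x
      using end_in that by (auto simp: support_face_def intro: order_antisym)
    then have "support_face K d = K" by (simp add: support_face_eq_self_iff)
    then show False using support_face_neq[OF dw(2,3)] by simp
  qed
  ultimately show "d = e" by simp
qed

lemma exposing_normal:
  assumes "v extreme_point_of K"
  obtains e where "e \<bullet> w = 0" "\<And>x. x \<in> K \<Longrightarrow> x \<noteq> v \<Longrightarrow> e \<bullet> x < e \<bullet> v"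
proof -
  have "{v} face_of K" using assms by (simp add: face_of_singleton)
  then obtain n where n: "{v} = support_face K n" using face_eq_support_face[OF polytope] by blast
  then have "v \<in> K" "\<forall>y\<in>K. n \<bullet> y \<le> n \<bullet> v" by (auto simp: support_face_def)
  have n_less: "n \<bullet> x < n \<bullet> v" if x: "x \<in> K" "x \<noteq> v" for x
  proof -
    have "x \<notin> support_face K n" using n x(2) by blast
    then obtain y where "y \<in> K" "n \<bullet> x < n \<bullet> y" using x(1) by (auto simp: support_face_def)
    then show ?thesis using \<open>\<forall>y\<in>K. n \<bullet> y \<le> n \<bullet> v\<close> by fastforce
  qed
  show ?thesis
  proof
    show "proj_plane w n \<bullet> w = 0" by (rule proj_plane_orthogonal)
    show "proj_plane w n \<bullet> x < proj_plane w n \<bullet> v" if "x \<in> K" "x \<noteq> v" for x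
    proof -
      have "(x - v) \<bullet> w = 0"
        using normal_const[OF that(1) \<open>v \<in> K\<close>] by (simp add: inner_diff_right inner_commute[of _ w])
      then have "(x - v) \<bullet> proj_plane w n = (x - v) \<bullet> n" by (rule inner_proj_plane)
      then show ?thesis
        using n_less[OF that]
        by (simp add: inner_commute[of _ n] inner_commute[of _ "proj_plane w n"] inner_diff_right)
    qed
  qed
qed

lemma edge_normals_edge_end:
  assumes v: "v extreme_point_of K"
  obtains d where "d \<in> edge_normals K w" "edge_end d = v"
proof -
  let ?V = "{x. x extreme_point_of K} - {v}"
  have hull: "K = convex hull {x. x extreme_point_of K}"
    by (intro Krein_Milman_Minkowski polytope_imp_compact polytope_imp_convex polytope)
  have finite_V: "finite ?V"
    using finite_polyhedron_extreme_points[OF polytope_imp_polyhedron[OF polytope]] by simp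
  have in_K: "x \<in> K" if "x extreme_point_of K" for x using that by (simp add: extreme_point_of_def)
  have "?V \<noteq> {}"
  proof
    assume "?V = {}"
    then have "{x. x extreme_point_of K} = {v}" using v by blast
    then have "K = {v}" using hull by simp
    then show False using aff_dim by simp
  qed
  obtain e where e: "e \<bullet> w = 0" "\<And>x. x \<in> K \<Longrightarrow> x \<noteq> v \<Longrightarrow> e \<bullet> x < e \<bullet> v"
    using exposing_normal[OF v] by blast
  then have e_exposes: "e \<bullet> x < e \<bullet> v" if "x \<in> ?V" for x using that in_K by blast
  obtain d x where d: "d \<bullet> w = 0" "\<And>y. y \<in> ?V \<Longrightarrow> d \<bullet> y \<le> d \<bullet> v" and x: "x \<in> ?V" "d \<bullet> x = d \<bullet> v"
    and end_side: "\<And>y. y \<in> ?V \<Longrightarrow> d \<bullet> y = d \<bullet> v \<Longrightarrow> cross3 w d \<bullet> y < cross3 w d \<bullet> v"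
    using rotate_supporting_line[OF finite_V \<open>?V \<noteq> {}\<close> normal_neq_0 e(1) e_exposes] by metis
  have "d \<noteq> 0" using end_side[OF x] by auto
  have "{x. x extreme_point_of K} \<subseteq> {y. d \<bullet> y \<le> d \<bullet> v}" using d(2) by auto
  then have "K \<subseteq> {y. d \<bullet> y \<le> d \<bullet> v}" using hull convex_halfspace_le hull_minimal by metis
  then have face: "v \<in> support_face K d" "x \<in> support_face K d"
    using in_K[OF v] in_K x by (auto simp: support_face_def)
  have "edge_end d = v" using end_side by (intro edge_end_eqI \<open>d \<noteq> 0\<close> d(1) face(1)) simp
  moreover have "(1 / norm d) *\<^sub>R d \<in> edge_normals K w"
    using face x(1) \<open>d \<noteq> 0\<close> d(1) by (auto simp: edge_normals_def support_face_scaleR)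
  ultimately show ?thesis using that edge_end_scaleR[of "1 / norm d" d] \<open>d \<noteq> 0\<close> by simp
qed

lemma card_extreme_points: "card {v. v extreme_point_of K} = card (edge_normals K w)"
proof -
  have "edge_end ` edge_normals K w = {v. v extreme_point_of K}"
  proof (intro equalityI subsetI; unfold mem_Collect_eq)
    fix v assume "v extreme_point_of K"
    then show "v \<in> edge_end ` edge_normals K w" using edge_normals_edge_end by blast
  qed (auto simp: edge_normals_def intro!: edge_end_extreme_point)
  then have "bij_betw edge_end (edge_normals K w) {v. v extreme_point_of K}"
    using inj_on_edge_end by (simp add: bij_betw_def)
  then show ?thesis by (rule bij_betw_same_card[symmetric])
qed

end

subsection \<open>Counting the vertices of a projection\<close>

definition transversal :: "R3 set \<Rightarrow> R3 \<Rightarrow> bool" where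
  "transversal R w \<longleftrightarrow> w \<noteq> 0 \<and> (\<forall>F. F facet_of R \<longrightarrow> \<not> plane_orth_to_facet w F)"

locale solid_polytope =
  fixes R :: "R3 set"
  assumes polytope: "polytope R"
    and aff_dim: "aff_dim R = 3"
begin

lemma nonempty: "R \<noteq> {}"
  using aff_dim by auto

lemma support_face_neq: "d \<noteq> 0 \<Longrightarrow> support_face R d \<noteq> R"
  using aff_dim by (intro full_dim_support_face_neq) simp_all

lemma facet_of_iff_support_face:
  "F facet_of R \<longleftrightarrow> (\<exists>d. d \<noteq> 0 \<and> F = support_face R d \<and> \<not> collinear F)"
proof
  assume F: "F facet_of R"
  then obtain d where d: "F = support_face R d"
    using face_eq_support_face[OF polytope] by (auto simp: facet_of_def)
  have "d \<noteq> 0" using F d by (auto simp: facet_of_def support_face_eq_self_iff[THEN iffD2])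
  moreover have "\<not> collinear F" using F aff_dim by (simp add: facet_of_def collinear_aff_dim)
  ultimately show "\<exists>d. d \<noteq> 0 \<and> F = support_face R d \<and> \<not> collinear F" using d by blast
next
  assume "\<exists>d. d \<noteq> 0 \<and> F = support_face R d \<and> \<not> collinear F"
  then obtain d where d: "d \<noteq> 0" "F = support_face R d" "\<not> collinear F" by blast
  have face: "F face_of R"
    unfolding d(2) by (intro support_face_face_of polytope_imp_convex polytope)
  then have "aff_dim F < 3"
    using face_of_aff_dim_lt[OF polytope_imp_convex[OF polytope]] support_face_neq[OF d(1)] d(2) aff_dim
    by metis
  then show "F facet_of R" using face d(3) aff_dim by (auto simp: facet_of_def collinear_aff_dim)
qed

lemma plane_orth_to_facet_iff:
  assumes "support_face R d facet_of R" "d \<noteq> 0"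
  shows "plane_orth_to_facet w (support_face R d) \<longleftrightarrow> d \<bullet> w = 0"
proof -
  have "span {x - y | x y. x \<in> support_face R d \<and> y \<in> support_face R d} = {x. d \<bullet> x = 0}"
    using assms aff_dim
    by (intro span_differences_eq_hyperplane support_face_inner_eq) (auto simp: facet_of_def)
  then show ?thesis by (simp add: plane_orth_to_facet_def)
qed

lemma transversal_iff_generic:
  "transversal R w \<longleftrightarrow> w \<noteq> 0 \<and> (\<forall>d. d \<noteq> 0 \<and> d \<bullet> w = 0 \<longrightarrow> generic_dir R d)"
proof -
  have "(\<forall>F. F facet_of R \<longrightarrow> \<not> plane_orth_to_facet w F) \<longleftrightarrow>
      (\<forall>d. d \<noteq> 0 \<and> d \<bullet> w = 0 \<longrightarrow> collinear (support_face R d))"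
    using plane_orth_to_facet_iff facet_of_iff_support_face by metis
  also have "\<dots> \<longleftrightarrow> (\<forall>d. d \<noteq> 0 \<and> d \<bullet> w = 0 \<longrightarrow> generic_dir R d)"
    unfolding generic_dir_def by (metis inner_minus_left neg_0_equal_iff_equal)
  finally show ?thesis unfolding transversal_def by blast
qed

lemma transversal_not_has_chord:
  assumes "transversal R w" "d \<noteq> 0"
  shows "\<not> has_chord (support_face R d) w"
proof
  assume chord: "has_chord (support_face R d) w"
  have "support_face R d face_of R" by (intro support_face_face_of polytope_imp_convex polytope)
  then obtain G where G: "G facet_of R" "support_face R d \<subseteq> G"
    using face_of_polyhedron_subset_facet[OF polytope_imp_polyhedron[OF polytope], of "support_face R d"]
      support_face_nonempty[OF polytope_imp_compact[OF polytope] nonempty] support_face_neq[OF assms(2)]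
    by blast
  obtain n where n: "n \<noteq> 0" "G = support_face R n" using G(1) facet_of_iff_support_face by blast
  have "has_chord (support_face R n) w" using has_chord_mono[OF chord G(2)] n(2) by simp
  then have "n \<bullet> w = 0" by (rule support_face_chord_orthogonal)
  then show False using plane_orth_to_facet_iff n G(1) assms(1) by (auto simp: transversal_def)
qed

lemma edge_direction_cross3_neq_0:
  assumes "transversal R w" "edge_direction R u"
  shows "cross3 u w \<noteq> 0"
proof
  assume "cross3 u w = 0"
  then have "u \<in> span {w}" using assms(1) by (simp add: in_span_iff_cross3_eq_0 transversal_def)
  then have span_eq: "span {u} = span {w}"
    using normalized_neq_0[OF edge_direction_normalized[OF assms(2)]] by (rule span_singleton_eq)
  obtain d where d: "collinear (support_face R d)" "has_chord (support_face R d) u"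
    using assms(2) edge_direction_iff_has_chord[OF polytope] by blast
  have "\<not> collinear R" using aff_dim by (simp add: collinear_aff_dim)
  then have "d \<noteq> 0" using d(1) by (auto simp: support_face_eq_self_iff[THEN iffD2])
  then have "\<not> has_chord (support_face R d) w" by (rule transversal_not_has_chord[OF assms(1)])
  moreover have "has_chord (support_face R d) w" using d(2) unfolding has_chord_def span_eq .
  ultimately show False by contradiction
qed

lemma edge_normals_proj_plane:
  assumes "transversal R w"
  shows "edge_normals (proj_plane w ` R) w = edge_normals R w"
proof -
  have inj: "inj_on (proj_plane w) (support_face R d)" if "norm d = 1" for d
  proof (rule inj_onI, rule ccontr)
    fix x y assume xy: "x \<in> support_face R d" "y \<in> support_face R d" "x \<noteq> y"
      and "proj_plane w x = proj_plane w y"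
    then have "x - y = (x \<bullet> w / (w \<bullet> w) - y \<bullet> w / (w \<bullet> w)) *\<^sub>R w"
      by (simp add: proj_plane_def algebra_simps)
    then have "x - y \<in> span {w}" unfolding span_singleton by blast
    then have "has_chord (support_face R d) w" using xy by (intro has_chordI)
    moreover have "d \<noteq> 0" using that by auto
    ultimately show False using transversal_not_has_chord[OF assms] by blast
  qed
  have "(\<exists>x\<in>support_face (proj_plane w ` R) d. \<exists>y\<in>support_face (proj_plane w ` R) d. x \<noteq> y) \<longleftrightarrow>
      (\<exists>x\<in>support_face R d. \<exists>y\<in>support_face R d. x \<noteq> y)" if "norm d = 1" "d \<bullet> w = 0" for d
    using inj_on_eq_iff[OF inj[OF that(1)]]
    by (simp add: support_face_proj_plane[OF that(2)] cong: bex_cong_simp)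
  then show ?thesis by (simp add: edge_normals_def cong: conj_cong)
qed

lemma card_extreme_points_proj_plane:
  assumes "transversal R w"
  shows "card {v. v extreme_point_of (proj_plane w ` R)} = card (edge_normals R w)"
proof -
  have w: "w \<noteq> 0" using assms by (simp add: transversal_def)
  interpret projection: planar_polygon "proj_plane w ` R" w
  proof
    show "polytope (proj_plane w ` R)" by (intro polytope_linear_image linear_proj_plane polytope)
    show "aff_dim (proj_plane w ` R) = 2" by (rule aff_dim_proj_plane[OF aff_dim w])
  qed (use w proj_plane_orthogonal in \<open>auto simp: inner_commute\<close>)
  show ?thesis using projection.card_extreme_points edge_normals_proj_plane[OF assms] by simp
qed

end

definition edge_count :: "'a::real_inner set \<Rightarrow> 'a \<Rightarrow> 'a \<Rightarrow> nat" where
  "edge_count P u d = of_bool (has_chord (support_face P d) u) +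
     of_bool (has_chord (support_face P (- d)) u)"

lemma edge_count_scaleR: "c \<noteq> 0 \<Longrightarrow> edge_count P u (c *\<^sub>R d) = edge_count P u d"
  using support_face_scaleR_cases[of c P d] by (auto simp: edge_count_def)

lemma edge_count_add_const:
  assumes "\<And>x y. x \<in> P \<Longrightarrow> y \<in> P \<Longrightarrow> m \<bullet> x = m \<bullet> y"
  shows "edge_count P u (a *\<^sub>R m + d) = edge_count P u d"
proof -
  have const: "(a *\<^sub>R m) \<bullet> x = (a *\<^sub>R m) \<bullet> y" "(- (a *\<^sub>R m)) \<bullet> x = (- (a *\<^sub>R m)) \<bullet> y"
    if "x \<in> P" "y \<in> P" for x y
    using assms[OF that] by simp_all
  have "- (a *\<^sub>R m + d) = - (a *\<^sub>R m) + - d" by simp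
  then show ?thesis
    unfolding edge_count_def
    by (simp only: support_face_add_const[OF const(1)] support_face_add_const[OF const(2)])
qed

lemma unit_orthogonal_pair:
  fixes u w :: R3
  assumes "cross3 u w \<noteq> 0"
  shows "{d. norm d = 1 \<and> d \<bullet> u = 0 \<and> d \<bullet> w = 0} = {sgn (cross3 u w), - sgn (cross3 u w)}"
proof (intro equalityI subsetI)
  fix d assume "d \<in> {d. norm d = 1 \<and> d \<bullet> u = 0 \<and> d \<bullet> w = 0}"
  then have d: "norm d = 1" "d \<bullet> u = 0" "d \<bullet> w = 0" by auto
  have "sgn (cross3 u w) \<in> span {cross3 u w}"
    unfolding sgn_div_norm by (intro span_scale span_base) simp
  then have "span {sgn (cross3 u w)} = span {cross3 u w}"
    using assms by (intro span_singleton_eq) (simp_all add: sgn_zero_iff)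
  then have "d \<in> span {sgn (cross3 u w)}" using orthogonal_in_span_cross3[OF d(2,3) assms] by simp
  then show "d \<in> {sgn (cross3 u w), - sgn (cross3 u w)}"
    using unit_in_span_cases[of d] d(1) assms by (auto simp: norm_sgn)
next
  fix d assume "d \<in> {sgn (cross3 u w), - sgn (cross3 u w)}"
  then show "d \<in> {d. norm d = 1 \<and> d \<bullet> u = 0 \<and> d \<bullet> w = 0}"
    using assms by (auto simp: norm_sgn sgn_div_norm dot_cross_self)
qed

definition edge_normals_along :: "R3 set \<Rightarrow> R3 \<Rightarrow> R3 \<Rightarrow> R3 set" where
  "edge_normals_along R w u = {d. norm d = 1 \<and> d \<bullet> w = 0 \<and> has_chord (support_face R d) u}"

lemma edge_normals_along_eq:
  assumes "cross3 u w \<noteq> 0"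
  shows "edge_normals_along R w u =
    {sgn (cross3 u w), - sgn (cross3 u w)} \<inter> {d. has_chord (support_face R d) u}"
  unfolding edge_normals_along_def unit_orthogonal_pair[OF assms, symmetric]
  using support_face_chord_orthogonal by auto

lemma finite_edge_normals_along: "cross3 u w \<noteq> 0 \<Longrightarrow> finite (edge_normals_along R w u)"
  by (simp add: edge_normals_along_eq)

lemma card_edge_normals_along:
  assumes "cross3 u w \<noteq> 0"
  shows "card (edge_normals_along R w u) = edge_count R u (cross3 u w)"
proof -
  let ?m = "sgn (cross3 u w)"
  have "?m \<noteq> - ?m" using assms by (simp add: sgn_zero_iff eq_neg_iff_add_eq_0 flip: scaleR_2)
  then have "card (edge_normals_along R w u) = edge_count R u ?m"
    unfolding edge_normals_along_eq[OF assms] edge_count_def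
    by (cases "has_chord (support_face R ?m) u"; cases "has_chord (support_face R (- ?m)) u") simp_all
  also have "\<dots> = edge_count R u (cross3 u w)"
    unfolding sgn_div_norm using assms by (intro edge_count_scaleR) simp
  finally show ?thesis .
qed

context solid_polytope
begin

lemma transversal_collinear_support_face:
  assumes "transversal R w" "norm d = 1" "d \<bullet> w = 0"
  shows "collinear (support_face R d)"
proof -
  have "d \<noteq> 0" using assms(2) by auto
  then show ?thesis using assms(1,3) by (simp add: transversal_iff_generic generic_dir_def)
qed

lemma edge_normals_eq_UN:
  assumes w: "transversal R w"
  shows "edge_normals R w = (\<Union>u\<in>{u. edge_direction R u}. edge_normals_along R w u)"
proof (intro equalityI subsetI)
  fix d assume "d \<in> edge_normals R w"
  then obtain x y where d: "norm d = 1" "d \<bullet> w = 0"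
    and xy: "x \<in> support_face R d" "y \<in> support_face R d" "x \<noteq> y"
    by (auto simp: edge_normals_def)
  obtain u where u: "normalized u" "x - y \<in> span {u}"
    using normalized_exists[of "x - y"] xy(3) by auto
  have "has_chord (support_face R d) u" using xy u(2) by (intro has_chordI)
  then show "d \<in> (\<Union>u\<in>{u. edge_direction R u}. edge_normals_along R w u)"
    using d u(1) transversal_collinear_support_face[OF w d]
    by (auto simp: edge_normals_along_def edge_direction_iff_has_chord[OF polytope])
qed (auto simp: edge_normals_along_def edge_normals_def has_chord_def)

lemma card_extreme_points_eq_sum:
  assumes w: "transversal R w"
  shows "card {v. v extreme_point_of (proj_plane w ` R)} =
    (\<Sum>u | edge_direction R u. edge_count R u (cross3 u w))"
proof -
  have "card {v. v extreme_point_of (proj_plane w ` R)} =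
      card (\<Union>u\<in>{u. edge_direction R u}. edge_normals_along R w u)"
    using card_extreme_points_proj_plane[OF w] edge_normals_eq_UN[OF w] by simp
  also have "\<dots> = (\<Sum>u | edge_direction R u. card (edge_normals_along R w u))"
  proof (rule card_UN_disjoint)
    show "\<forall>u\<in>{u. edge_direction R u}. finite (edge_normals_along R w u)"
      using finite_edge_normals_along edge_direction_cross3_neq_0[OF w] by blast
    show "\<forall>u\<in>{u. edge_direction R u}. \<forall>v\<in>{u. edge_direction R u}.
        u \<noteq> v \<longrightarrow> edge_normals_along R w u \<inter> edge_normals_along R w v = {}"
      using collinear_has_chord_unique[OF transversal_collinear_support_face[OF w]]
        edge_direction_normalized
      unfolding edge_normals_along_def by blast
  qed (rule finite_edge_directions[OF polytope])
  also have "\<dots> = (\<Sum>u | edge_direction R u. edge_count R u (cross3 u w))"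
    using edge_direction_cross3_neq_0[OF w] by (intro sum.cong refl card_edge_normals_along) simp
  finally show ?thesis .
qed

end

subsection \<open>Equiprojectivity in terms of edge counts\<close>

lemma edge_count_eq_0: "\<not> has_chord P u \<Longrightarrow> edge_count P u d = 0"
  using has_chord_mono[OF _ support_face_subset] by (auto simp: edge_count_def)

lemma edge_count_eq_0_if_not_edge_direction:
  assumes "polytope P" "normalized u" "\<not> edge_direction P u" "generic_dir P d"
  shows "edge_count P u d = 0"
  using assms by (auto simp: edge_count_def generic_dir_def edge_direction_iff_has_chord)

lemma eventually_edge_count_eq:
  fixes P :: "'a::euclidean_space set"
  assumes "polytope P" "P \<noteq> {}" "generic_dir P d"
  shows "\<forall>\<^sub>F e in nhds d. e \<bullet> u = 0 \<longrightarrow> edge_count P u e = edge_count P u d"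
proof -
  have edges: "collinear (support_face P d)" "collinear (support_face P (- d))"
    using assms(3) by (simp_all add: generic_dir_def)
  have "filterlim uminus (nhds (- d)) (nhds d)"
    by (rule tendsto_minus[OF filterlim_ident])
  from eventually_compose_filterlim[OF eventually_has_chord_eq[OF assms(1,2) edges(2), of u] this]
  have "\<forall>\<^sub>F e in nhds d. e \<bullet> u = 0 \<longrightarrow>
    has_chord (support_face P (- e)) u = has_chord (support_face P (- d)) u" by simp
  with eventually_has_chord_eq[OF assms(1,2) edges(1), of u] show ?thesis
    by eventually_elim (simp add: edge_count_def)
qed

lemma edge_count_constant_if_off_lines:
  assumes P: "polytope P" "P \<noteq> {}" and u: "u \<noteq> 0" and B: "finite B"
    and const: "edge_count P u constant_on (generic_normals P u - (\<Union>b\<in>B. span {b}))"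
  shows "edge_count P u constant_on generic_normals P u"
proof -
  let ?G = "generic_normals P u - (\<Union>b\<in>B. span {b})"
  obtain k where count_eq: "\<And>e. e \<in> ?G \<Longrightarrow> edge_count P u e = k"
    using const unfolding constant_on_def by blast
  have "edge_count P u d = k" if d: "d \<in> generic_normals P u" for d
  proof -
    have "generic_dir P d" using d by (simp add: mem_generic_normals)
    then obtain r where near: "r > 0"
      "\<And>e. dist e d < r \<Longrightarrow> e \<bullet> u = 0 \<Longrightarrow> edge_count P u e = edge_count P u d"
      using eventually_edge_count_eq[OF P, of d u] unfolding eventually_nhds_metric by blast
    have "d \<in> closure ?G"
      using orth_plane_subset_closure[OF P(1) u B] d by (auto simp: generic_normals_def)
    then obtain e where e: "e \<in> ?G" "dist e d < r"
      using near(1) unfolding closure_approachable by blast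
    then have "e \<bullet> u = 0" by (simp add: mem_generic_normals)
    then show ?thesis using count_eq[OF e(1)] near(2)[OF e(2)] by simp
  qed
  then show ?thesis unfolding constant_on_def by blast
qed

lemma eventually_edge_count_perturb:
  fixes P :: "'a::euclidean_space set"
  assumes "polytope P" "P \<noteq> {}"
  shows "\<forall>\<^sub>F s in at_right 0. edge_count P u (m + s *\<^sub>R y) + edge_count P u (m - s *\<^sub>R y) =
    edge_count (support_face P m) u y + edge_count (support_face P (- m)) u y"
proof -
  have perturb: "\<forall>\<^sub>F s in at_right 0.
      support_face P (c + s *\<^sub>R z) = support_face (support_face P c) z" for c z
    by (rule eventually_support_face_perturb[OF assms])
  show ?thesis
    using perturb[of m y] perturb[of m "- y"] perturb[of "- m" y] perturb[of "- m" "- y"]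
  proof eventually_elim
    case (elim s)
    have "- (m + s *\<^sub>R y) = - m + s *\<^sub>R (- y)" "m - s *\<^sub>R y = m + s *\<^sub>R (- y)"
      "- (m - s *\<^sub>R y) = - m + s *\<^sub>R y" by simp_all
    then show ?case unfolding edge_count_def by (simp only: elim)
  qed
qed

definition has_symmetric_edge_sum :: "R3 set \<Rightarrow> R3 \<Rightarrow> R3 \<Rightarrow> nat \<Rightarrow> bool" where
  "has_symmetric_edge_sum P u u\<^sub>0 T \<longleftrightarrow> (\<forall>v. v \<bullet> cross3 u u\<^sub>0 \<noteq> 0 \<longrightarrow> (\<forall>\<^sub>F s in at_right 0.
     edge_count P u (cross3 u (u\<^sub>0 + s *\<^sub>R v)) + edge_count P u (cross3 u (u\<^sub>0 - s *\<^sub>R v)) = T))"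

text \<open>Near \<open>u\<^sub>0\<close> the count along a direction \<open>u\<close> not parallel to \<open>u\<^sub>0\<close> can only jump across the plane
  spanned by \<open>u\<close> and \<open>u\<^sub>0\<close>, so its values at two points symmetric about \<open>u\<^sub>0\<close> have a constant sum.\<close>

lemma has_symmetric_edge_sum_exists:
  fixes P :: "R3 set"
  assumes P: "polytope P" "P \<noteq> {}" and cross_neq_0: "cross3 u u\<^sub>0 \<noteq> 0"
  shows "\<exists>T. has_symmetric_edge_sum P u u\<^sub>0 T"
proof -
  define m where "m = cross3 u u\<^sub>0"
  define n where "n = cross3 u m"
  have m: "m \<bullet> u = 0" by (simp add: m_def dot_cross_self)
  have u: "u \<noteq> 0" using cross_neq_0 by auto
  have side: "edge_count (support_face P c) u (a *\<^sub>R m + b *\<^sub>R n) = edge_count (support_face P c) u n"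
    if "c = m \<or> c = - m" "b \<noteq> 0" for a b c
  proof -
    have "m \<bullet> x = m \<bullet> y" if "x \<in> support_face P c" "y \<in> support_face P c" for x y
      using support_face_inner_eq[OF that] \<open>c = m \<or> c = - m\<close> by auto
    then show ?thesis using edge_count_add_const edge_count_scaleR[OF that(2)] by metis
  qed
  have "has_symmetric_edge_sum P u u\<^sub>0
      (edge_count (support_face P m) u n + edge_count (support_face P (- m)) u n)"
    unfolding has_symmetric_edge_sum_def
  proof (intro allI impI)
    fix v assume "v \<bullet> cross3 u u\<^sub>0 \<noteq> 0"
    then obtain a b where y: "cross3 u v = a *\<^sub>R m + b *\<^sub>R n" "b \<noteq> 0"
      using cross3_plane_decomposition[OF m u, of v] by (auto simp: m_def n_def)
    have "cross3 u (u\<^sub>0 + s *\<^sub>R v) = m + s *\<^sub>R cross3 u v"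
      "cross3 u (u\<^sub>0 - s *\<^sub>R v) = m - s *\<^sub>R cross3 u v" for s
      by (simp_all add: m_def cross_add_right Cross3.right_diff_distrib cross_mult_right)
    then show "\<forall>\<^sub>F s in at_right 0.
        edge_count P u (cross3 u (u\<^sub>0 + s *\<^sub>R v)) + edge_count P u (cross3 u (u\<^sub>0 - s *\<^sub>R v)) =
        edge_count (support_face P m) u n + edge_count (support_face P (- m)) u n"
      using eventually_edge_count_perturb[OF P, of u m "cross3 u v"] y by (simp add: side)
  qed
  then show ?thesis ..
qed

context solid_polytope
begin

lemma eventually_transversal:
  assumes generic: "generic_dir R (cross3 u v)"
  shows "\<forall>\<^sub>F s in at_right 0. transversal R (u + s *\<^sub>R v)"
proof -
  have uv: "cross3 u v \<noteq> 0" using generic by (simp add: generic_dir_def)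
  obtain B where B: "finite B" "{d. \<not> generic_dir R d} = (\<Union>b\<in>B. span {b})"
    using nongeneric_eq_lines[OF polytope] .
  have "b \<bullet> u \<noteq> 0 \<or> b \<bullet> v \<noteq> 0" if b: "b \<in> B - {0}" for b
  proof (rule ccontr)
    assume "\<not> ?thesis"
    then have "b \<in> span {cross3 u v}" by (intro orthogonal_in_span_cross3 uv) auto
    then obtain c where "b = c *\<^sub>R cross3 u v" by (auto simp: span_singleton)
    then have "generic_dir R b" using generic_dir_scaleR[OF generic, of c] b by auto
    moreover have "b \<in> (\<Union>b\<in>B. span {b})" using b span_base[of b "{b}"] by blast
    ultimately show False using B(2) by blast
  qed
  then have "\<forall>\<^sub>F s in at_right (0::real). \<forall>b\<in>B - {0}. b \<bullet> (u + s *\<^sub>R v) \<noteq> 0"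
    using B(1) by (intro eventually_ball_finite ballI eventually_not_orthogonal) auto
  then show ?thesis
  proof eventually_elim
    case (elim s)
    have "cross3 (u + s *\<^sub>R v) v = cross3 u v" by (simp add: cross_add_left cross_mult_left)
    then have "u + s *\<^sub>R v \<noteq> 0" using uv by auto
    moreover have "generic_dir R d" if d: "d \<noteq> 0" "d \<bullet> (u + s *\<^sub>R v) = 0" for d
    proof (rule ccontr)
      assume "\<not> generic_dir R d"
      then obtain b where b: "b \<in> B" "d \<in> span {b}" using B(2) by blast
      then obtain c where "d = c *\<^sub>R b" by (auto simp: span_singleton)
      then show False using d elim b(1) by auto
    qed
    ultimately show ?case by (simp add: transversal_iff_generic)
  qed
qed

lemma k_equiprojective_iff:
  "k_equiprojective k R \<longleftrightarrow>
    (\<forall>w. transversal R w \<longrightarrow> card {v. v extreme_point_of (proj_plane w ` R)} = k)"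
proof -
  have "polytope (proj_plane w ` R)" for w
    by (intro polytope_linear_image linear_proj_plane polytope)
  then show ?thesis
    using polytope aff_dim aff_dim_proj_plane[OF aff_dim]
    unfolding k_equiprojective_def transversal_def by blast
qed

lemma k_equiprojective_sum_edge_count:
  "k_equiprojective k R \<Longrightarrow> transversal R w \<Longrightarrow> (\<Sum>u | edge_direction R u. edge_count R u (cross3 u w)) = k"
  by (simp add: k_equiprojective_iff card_extreme_points_eq_sum)

lemma twice_edge_count_add_sums:
  assumes equiprojective: "k_equiprojective k R" and u\<^sub>0: "edge_direction R u\<^sub>0"
    and sums: "\<And>u. edge_direction R u \<Longrightarrow> u \<noteq> u\<^sub>0 \<Longrightarrow> has_symmetric_edge_sum R u u\<^sub>0 (T u)"
    and d: "generic_dir R d" "d \<bullet> u\<^sub>0 = 0" "\<And>u. edge_direction R u \<Longrightarrow> u \<noteq> u\<^sub>0 \<Longrightarrow> d \<bullet> u \<noteq> 0"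
  shows "2 * edge_count R u\<^sub>0 d + (\<Sum>u\<in>{u. edge_direction R u} - {u\<^sub>0}. T u) = 2 * k"
proof -
  let ?U = "{u. edge_direction R u}"
  define v where "v = cross3 d u\<^sub>0"
  have finite_U: "finite ?U" by (rule finite_edge_directions[OF polytope])
  have unit: "u\<^sub>0 \<bullet> u\<^sub>0 = 1" using edge_direction_normalized[OF u\<^sub>0] by (simp add: normalized_def norm_eq_1)
  have cross_v: "cross3 u\<^sub>0 v = d" using unit d(2) by (simp add: v_def Lagrange inner_commute)
  have "v \<bullet> cross3 u u\<^sub>0 = d \<bullet> u" for u using unit d(2) by (simp add: v_def dot_cross)
  then have "\<forall>\<^sub>F s in at_right 0. \<forall>u\<in>?U - {u\<^sub>0}. edge_count R u (cross3 u (u\<^sub>0 + s *\<^sub>R v)) +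
      edge_count R u (cross3 u (u\<^sub>0 - s *\<^sub>R v)) = T u"
    using sums d(3) finite_U unfolding has_symmetric_edge_sum_def by (intro eventually_ball_finite) auto
  moreover have "\<forall>\<^sub>F s in at_right 0. transversal R (u\<^sub>0 + s *\<^sub>R v)"
    "\<forall>\<^sub>F s in at_right 0. transversal R (u\<^sub>0 + s *\<^sub>R (- v))"
    using d(1) by (intro eventually_transversal; simp add: cross_v generic_dir_minus_iff)+
  moreover have "\<forall>\<^sub>F s in at_right (0::real). s > 0" by (simp add: eventually_at_right_less)
  ultimately have "\<forall>\<^sub>F s in at_right (0::real).
      2 * edge_count R u\<^sub>0 d + (\<Sum>u\<in>?U - {u\<^sub>0}. T u) = 2 * k"
  proof eventually_elim
    case (elim s)
    have "2 * k = (\<Sum>u\<in>?U. edge_count R u (cross3 u (u\<^sub>0 + s *\<^sub>R v)) +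
        edge_count R u (cross3 u (u\<^sub>0 - s *\<^sub>R v)))"
      using k_equiprojective_sum_edge_count[OF equiprojective] elim(2,3) by (simp add: sum.distrib)
    also have "\<dots> = edge_count R u\<^sub>0 (cross3 u\<^sub>0 (u\<^sub>0 + s *\<^sub>R v)) +
        edge_count R u\<^sub>0 (cross3 u\<^sub>0 (u\<^sub>0 - s *\<^sub>R v)) + (\<Sum>u\<in>?U - {u\<^sub>0}. T u)"
      using finite_U u\<^sub>0 elim(1) by (subst sum.remove[of _ u\<^sub>0]) auto
    also have "cross3 u\<^sub>0 (u\<^sub>0 + s *\<^sub>R v) = s *\<^sub>R d"
      by (simp add: cross_add_right cross_mult_right cross_v)
    also have "cross3 u\<^sub>0 (u\<^sub>0 - s *\<^sub>R v) = (- s) *\<^sub>R d"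
      by (simp add: Cross3.right_diff_distrib cross_mult_right cross_v)
    finally show ?case using elim(4) by (simp add: edge_count_scaleR del: scaleR_minus_left)
  qed
  then show ?thesis by simp
qed

lemma k_equiprojective_imp_edge_count_constant:
  assumes equiprojective: "k_equiprojective k R" and u\<^sub>0: "normalized u\<^sub>0"
  shows "edge_count R u\<^sub>0 constant_on generic_normals R u\<^sub>0"
proof (cases "edge_direction R u\<^sub>0")
  case False
  then have "edge_count R u\<^sub>0 d = 0" if "d \<in> generic_normals R u\<^sub>0" for d
    using edge_count_eq_0_if_not_edge_direction[OF polytope u\<^sub>0] that by (simp add: mem_generic_normals)
  then show ?thesis unfolding constant_on_def by blast
next
  case True
  let ?U = "{u. edge_direction R u} - {u\<^sub>0}"
  have cross: "cross3 u u\<^sub>0 \<noteq> 0" if "u \<in> ?U" for u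
    using that normalized_cross3_neq_0[OF edge_direction_normalized u\<^sub>0] by blast
  have "\<forall>u\<in>?U. \<exists>T. has_symmetric_edge_sum R u u\<^sub>0 T"
    by (intro ballI has_symmetric_edge_sum_exists polytope nonempty cross)
  from bchoice[OF this] obtain T where sums: "\<forall>u\<in>?U. has_symmetric_edge_sum R u u\<^sub>0 (T u)" ..
  let ?B = "(\<lambda>u. cross3 u u\<^sub>0) ` ?U"
  show ?thesis
  proof (rule edge_count_constant_if_off_lines[OF polytope nonempty normalized_neq_0[OF u\<^sub>0]])
    show "finite ?B" using finite_edge_directions[OF polytope] by simp
    have "edge_count R u\<^sub>0 d = (2 * k - (\<Sum>u\<in>?U. T u)) div 2"
      if d: "d \<in> generic_normals R u\<^sub>0 - (\<Union>b\<in>?B. span {b})" for d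
    proof -
      have "d \<bullet> u \<noteq> 0" if u: "u \<in> ?U" for u
      proof
        assume "d \<bullet> u = 0"
        then have "d \<in> span {cross3 u u\<^sub>0}"
          using d by (intro orthogonal_in_span_cross3 cross u) (simp_all add: mem_generic_normals)
        then show False using d u by blast
      qed
      then have "2 * edge_count R u\<^sub>0 d + (\<Sum>u\<in>?U. T u) = 2 * k"
        using sums d
        by (intro twice_edge_count_add_sums equiprojective True) (auto simp: mem_generic_normals)
      then show ?thesis by simp
    qed
    then show "edge_count R u\<^sub>0 constant_on (generic_normals R u\<^sub>0 - (\<Union>b\<in>?B. span {b}))"
      unfolding constant_on_def by blast
  qed
qed

lemma k_equiprojective_if_edge_count_constant:
  assumes "\<And>u. normalized u \<Longrightarrow> edge_count R u constant_on generic_normals R u"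
  shows "\<exists>k. k_equiprojective k R"
proof -
  obtain c where count_eq: "\<And>u d. normalized u \<Longrightarrow> d \<in> generic_normals R u \<Longrightarrow> edge_count R u d = c u"
    using assms unfolding constant_on_def by metis
  have "card {v. v extreme_point_of (proj_plane w ` R)} = (\<Sum>u | edge_direction R u. c u)"
    if w: "transversal R w" for w
    unfolding card_extreme_points_eq_sum[OF w]
  proof (rule sum.cong[OF refl])
    fix u assume "u \<in> {u. edge_direction R u}"
    then have u: "edge_direction R u" by simp
    have "generic_dir R (cross3 u w)"
      using w edge_direction_cross3_neq_0[OF w u] by (simp add: transversal_iff_generic dot_cross_self)
    then show "edge_count R u (cross3 u w) = c u"
      using edge_direction_normalized[OF u]
      by (intro count_eq) (simp_all add: mem_generic_normals dot_cross_self)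
  qed
  then show ?thesis unfolding k_equiprojective_iff by blast
qed

theorem equiprojective_iff_edge_count_constant:
  "equiprojective R \<longleftrightarrow> (\<forall>u. normalized u \<longrightarrow> edge_count R u constant_on generic_normals R u)"
  unfolding equiprojective_def
  using k_equiprojective_imp_edge_count_constant k_equiprojective_if_edge_count_constant by blast

end

lemma polygon_edge_count_constant:
  assumes P: "polytope P" "aff_dim P = 2" and u: "u \<noteq> 0"
  shows "edge_count P u constant_on generic_normals P u"
proof -
  obtain n r where n: "n \<noteq> 0" "P \<subseteq> {x. n \<bullet> x = r}"
    using aff_lowdim_subset_hyperplane[of P] P by auto
  have n_const: "n \<bullet> x = n \<bullet> y" if "x \<in> P" "y \<in> P" for x y
  proof -
    have "n \<bullet> x = r" "n \<bullet> y = r" using that n(2) by blast+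
    then show ?thesis by simp
  qed
  show ?thesis
  proof (cases "n \<bullet> u = 0")
    case False
    then have "\<not> has_chord P u" using has_chord_inner_eq_0 n_const by metis
    then show ?thesis unfolding constant_on_def using edge_count_eq_0 by blast
  next
    case True
    have "edge_count P u d = edge_count P u (cross3 u n)" if d: "d \<in> generic_normals P u" for d
    proof -
      obtain a b where ab: "d = a *\<^sub>R n + b *\<^sub>R cross3 u n"
        using orthogonal_plane_decomposition[OF True n(1) u, of d] d by (auto simp: mem_generic_normals)
      have "b \<noteq> 0"
      proof
        assume "b = 0"
        then have "d \<bullet> x = d \<bullet> y" if "x \<in> P" "y \<in> P" for x y using n_const[OF that] ab by simp
        then have "support_face P d = P" unfolding support_face_eq_self_iff by blast
        then have "collinear P" using d by (simp add: mem_generic_normals generic_dir_def)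
        then show False using P by (simp add: collinear_aff_dim)
      qed
      then have "edge_count P u (b *\<^sub>R cross3 u n) = edge_count P u (cross3 u n)"
        by (rule edge_count_scaleR)
      then show ?thesis using edge_count_add_const[of P n u a "b *\<^sub>R cross3 u n", OF n_const] ab by simp
    qed
    then show ?thesis unfolding constant_on_def by blast
  qed
qed

lemma collinear_edge_count_constant:
  fixes P :: "R3 set"
  assumes "collinear P"
  shows "edge_count P u constant_on orth_plane u"
proof (cases "has_chord P u")
  case True
  have "support_face P d = P" if "d \<bullet> u = 0" for d
    unfolding support_face_eq_self_iff using collinear_has_chord_inner_eq[OF assms True that] by blast
  then have "edge_count P u d = 2" if "d \<in> orth_plane u" for d
    using that True by (simp add: edge_count_def orth_plane_def inner_commute[of d])
  then show ?thesis unfolding constant_on_def by blast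
next
  case False
  then show ?thesis unfolding constant_on_def using edge_count_eq_0 by blast
qed

lemma admissible_summand_edge_count_constant:
  assumes "admissible_summand P" "normalized u"
  shows "edge_count P u constant_on generic_normals P u"
  using assms(1) unfolding admissible_summand_def
proof (elim disjE conjE)
  assume equiprojective: "equiprojective P"
  then interpret solid_polytope P
    by unfold_locales (auto simp: equiprojective_def k_equiprojective_def)
  show ?thesis using equiprojective assms(2) by (simp add: equiprojective_iff_edge_count_constant)
next
  assume "polytope P" "aff_dim P = 2"
  then show ?thesis by (rule polygon_edge_count_constant[OF _ _ normalized_neq_0[OF assms(2)]])
next
  assume "aff_dim P = 1"
  then have "collinear P" by (simp add: collinear_aff_dim)
  then show ?thesis
    using constant_on_subset[OF collinear_edge_count_constant] by (auto simp: generic_normals_def)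
qed

lemma admissible_summandD:
  assumes "admissible_summand P"
  shows "polytope P" "P \<noteq> {}"
  using assms by (auto simp: admissible_summand_def equiprojective_def k_equiprojective_def)

subsection \<open>Aggregated cones\<close>

lemma normal_cone_eq: "F \<subseteq> P \<Longrightarrow> normal_cone P F = {d. F \<subseteq> support_face P d}"
  by (auto simp: normal_cone_def support_face_def)

lemma aff_dim_normal_cone_edge:
  assumes P: "polytope P" "P \<noteq> {}" and u: "u \<noteq> 0"
    and edge: "collinear (support_face P d)" "has_chord (support_face P d) u"
  shows "aff_dim (normal_cone P (support_face P d)) = 2"
    and "normal_cone P (support_face P d) \<subseteq> orth_plane u"
proof -
  have cone_eq: "normal_cone P (support_face P d) = {e. support_face P d \<subseteq> support_face P e}" (is "?N = _")
    by (rule normal_cone_eq[OF support_face_subset])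
  show cone_sub: "?N \<subseteq> orth_plane u"
  proof
    fix e assume "e \<in> ?N"
    then have "has_chord (support_face P e) u" using cone_eq has_chord_mono[OF edge(2)] by blast
    then show "e \<in> orth_plane u"
      using support_face_chord_orthogonal by (auto simp: orth_plane_def inner_commute)
  qed
  obtain r where near: "r > 0" "\<And>e. dist e d < r \<Longrightarrow> e \<bullet> u = 0 \<Longrightarrow> support_face P e = support_face P d"
    using eventually_support_face_eq[OF P edge] unfolding eventually_nhds_metric by blast
  have "d \<in> orth_plane u \<inter> ball d r"
    using near(1) support_face_chord_orthogonal[OF edge(2)] by (simp add: orth_plane_def inner_commute)
  then have "orth_plane u \<inter> ball d r \<noteq> {}" by blast
  then have "aff_dim (orth_plane u \<inter> ball d r) = 2"
    by (simp add: aff_dim_convex_Int_open convex_orth_plane aff_dim_orth_plane u)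
  moreover have "orth_plane u \<inter> ball d r \<subseteq> ?N"
    using near(2) unfolding cone_eq by (auto simp: orth_plane_def inner_commute dist_commute)
  ultimately show "aff_dim ?N = 2"
    using aff_dim_subset[of "orth_plane u \<inter> ball d r" ?N] aff_dim_subset[OF cone_sub]
      aff_dim_orth_plane[OF u] by simp
qed

lemma aff_dim_normal_cone_vertex:
  assumes P: "polytope P" "P \<noteq> {}" and v: "support_face P d = {v}"
  shows "aff_dim (normal_cone P {v}) = 3"
proof -
  have "\<forall>\<^sub>F e in nhds d. support_face P e \<subseteq> {v}"
    using eventually_support_face_subset[OF P(1), of d] v by simp
  then have "\<forall>\<^sub>F e in nhds d. e \<in> normal_cone P {v}"
  proof eventually_elim
    case (elim e)
    then have "support_face P e = {v}"
      using support_face_nonempty[OF polytope_imp_compact[OF P(1)] P(2), of e] by blast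
    moreover have "{v} \<subseteq> P" using support_face_subset v by metis
    ultimately show ?case by (simp add: normal_cone_eq)
  qed
  then have "d \<in> interior (normal_cone P {v})"
    by (auto simp: eventually_nhds interior_def)
  then have "interior (normal_cone P {v}) \<noteq> {}" by blast
  then show ?thesis by (simp add: aff_dim_nonempty_interior)
qed

lemma has_chord_if_normal_cone:
  assumes P: "polytope P" and F: "F face_of P" "F \<noteq> {}" and u: "u \<noteq> 0"
    and cone: "aff_dim (normal_cone P F) = 2" "normal_cone P F \<subseteq> orth_plane u"
  shows "has_chord F u"
proof -
  have F_subset: "F \<subseteq> P" using F(1) by (rule face_of_imp_subset)
  obtain d where d: "F = support_face P d" using face_eq_support_face[OF P F] .
  have "P \<noteq> {}" using F_subset F(2) by blast
  then have "F \<noteq> {v}" for v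
    using aff_dim_normal_cone_vertex[OF P, of d v] d cone(1) by auto
  then obtain x y where xy: "x \<in> F" "y \<in> F" "x \<noteq> y" using F(2) by blast
  have "x - y \<in> span {u}"
  proof (rule ccontr)
    assume "x - y \<notin> span {u}"
    then have cross: "cross3 (x - y) u \<noteq> 0" using in_span_iff_cross3_eq_0[OF u] by simp
    have "e \<in> span {cross3 (x - y) u}" if e: "e \<in> normal_cone P F" for e
    proof (rule orthogonal_in_span_cross3[OF _ _ cross])
      have "F \<subseteq> support_face P e" using e by (simp add: normal_cone_eq[OF F_subset])
      then have "e \<bullet> x = e \<bullet> y" using xy support_face_inner_eq by blast
      then show "e \<bullet> (x - y) = 0" by (simp add: inner_diff_right)
      show "e \<bullet> u = 0" using e cone(2) by (auto simp: orth_plane_def inner_commute)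
    qed
    then have "collinear (normal_cone P F)" by (intro subset_span_singleton_imp_collinear subsetI)
    then show False using cone(1) by (simp add: collinear_aff_dim)
  qed
  then show ?thesis using xy by (intro has_chordI)
qed

lemma aggregated_cone_iff_has_chord:
  assumes P: "polytope P" "P \<noteq> {}" and u: "u \<noteq> 0" and edge: "collinear (support_face P d)"
  shows "d \<in> aggregated_cone P u \<longleftrightarrow> has_chord (support_face P d) u"
proof
  assume "d \<in> aggregated_cone P u"
  then obtain F where F: "F face_of P" "F \<noteq> {}" "aff_dim (normal_cone P F) = 2"
    "normal_cone P F \<subseteq> orth_plane u" "d \<in> normal_cone P F"
    by (auto simp: aggregated_cone_def)
  then have "F \<subseteq> support_face P d" by (simp add: normal_cone_eq face_of_imp_subset)
  then show "has_chord (support_face P d) u"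
    using has_chord_mono has_chord_if_normal_cone[OF P(1) F(1,2) u F(3,4)] by blast
next
  assume chord: "has_chord (support_face P d) u"
  have "support_face P d face_of P" "support_face P d \<noteq> {}"
    using P
    by (simp_all add: support_face_face_of polytope_imp_convex support_face_nonempty polytope_imp_compact)
  moreover have "d \<in> normal_cone P (support_face P d)"
    by (simp add: normal_cone_eq[OF support_face_subset])
  ultimately show "d \<in> aggregated_cone P u"
    unfolding aggregated_cone_def using aff_dim_normal_cone_edge[OF P u edge chord] by blast
qed

lemma closed_aggregated_cone:
  assumes "polytope P"
  shows "closed (aggregated_cone P u)"
  unfolding aggregated_cone_def
proof (rule closed_Union)
  show "finite {normal_cone P F | F. F face_of P \<and> F \<noteq> {} \<and> aff_dim (normal_cone P F) = 2 \<and>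
      normal_cone P F \<subseteq> orth_plane u}"
    using finite_polytope_faces[OF assms] by simp
qed (auto simp: normal_cone_eq face_of_imp_subset closed_supporting_functionals)

lemma closure_aggregated_cone_generic:
  assumes "polytope P" "polytope R"
  shows "closure (aggregated_cone P u \<inter> generic_normals R u) = aggregated_cone P u" (is "closure ?C = _")
proof (rule equalityI)
  show "closure ?C \<subseteq> aggregated_cone P u"
    by (intro closure_minimal closed_aggregated_cone assms) simp
  have "normal_cone P F \<subseteq> closure ?C"
    if F: "F face_of P" "F \<noteq> {}" "aff_dim (normal_cone P F) = 2" "normal_cone P F \<subseteq> orth_plane u" for F
  proof -
    have "convex (normal_cone P F)"
      using face_of_imp_subset[OF F(1)] by (simp add: normal_cone_eq convex_supporting_functionals)
    then have "normal_cone P F \<subseteq> closure {d \<in> normal_cone P F. generic_dir R d}"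
      using subset_closure_generic_minus_lines[OF assms(2), of _ "{}"] F(3) by (simp add: collinear_aff_dim)
    also have "\<dots> \<subseteq> closure ?C"
      using F by (intro closure_mono) (auto simp: aggregated_cone_def generic_normals_def)
    finally show ?thesis .
  qed
  then show "aggregated_cone P u \<subseteq> closure ?C" unfolding aggregated_cone_def by blast
qed

lemma closure_generic_normals:
  assumes "polytope R" "u \<noteq> 0"
  shows "closure (generic_normals R u) = orth_plane u"
proof
  show "closure (generic_normals R u) \<subseteq> orth_plane u"
    by (intro closure_minimal closed_orth_plane) (simp add: generic_normals_def)
  show "orth_plane u \<subseteq> closure (generic_normals R u)"
    using orth_plane_subset_closure[OF assms, of "{}"] by simp
qed

lemma edge_direction_iff_aggregated_cone:
  assumes P: "polytope P" "P \<noteq> {}" and u: "normalized u"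
  shows "edge_direction P u \<longleftrightarrow> aggregated_cone P u \<noteq> {}"
proof
  assume "edge_direction P u"
  then show "aggregated_cone P u \<noteq> {}"
    using aggregated_cone_iff_has_chord[OF P normalized_neq_0[OF u]]
    by (auto simp: edge_direction_iff_has_chord[OF P(1)])
next
  assume "aggregated_cone P u \<noteq> {}"
  then have "aggregated_cone P u \<inter> generic_normals P u \<noteq> {}"
    using closure_aggregated_cone_generic[OF P(1) P(1), of u] by force
  then obtain d where "d \<in> aggregated_cone P u" "collinear (support_face P d)"
    by (auto simp: mem_generic_normals generic_dir_def)
  then show "edge_direction P u"
    using u aggregated_cone_iff_has_chord[OF P normalized_neq_0[OF u]]
    by (auto simp: edge_direction_iff_has_chord[OF P(1)])
qed

subsection \<open>Counting antipodal points\<close>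

definition antipodal_count :: "'a::real_vector set \<Rightarrow> 'a \<Rightarrow> nat" where
  "antipodal_count C d = of_bool (d \<in> C) + of_bool (- d \<in> C)"

lemma mem_uminus_image:
  fixes d :: "'a::group_add"
  shows "d \<in> uminus ` B \<longleftrightarrow> - d \<in> B"
  by (metis image_iff minus_minus)

lemma antipodal_complement:
  assumes "antipodal_count A constant_on G" "G \<inter> A \<noteq> {}" "\<not> G \<subseteq> A" "d \<in> G"
  shows "- d \<in> A \<longleftrightarrow> d \<notin> A"
proof -
  obtain k where count_eq: "\<And>d. d \<in> G \<Longrightarrow> antipodal_count A d = k"
    using assms(1) unfolding constant_on_def by blast
  obtain x y where "x \<in> G" "x \<in> A" "y \<in> G" "y \<notin> A" using assms(2,3) by blast
  then have "antipodal_count A x \<ge> 1" "antipodal_count A y \<le> 1" by (simp_all add: antipodal_count_def)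
  then have "k = 1" using count_eq \<open>x \<in> G\<close> \<open>y \<in> G\<close> by simp
  then have "antipodal_count A d = 1" using count_eq[OF assms(4)] by simp
  then show ?thesis by (cases "d \<in> A"; cases "- d \<in> A") (simp_all add: antipodal_count_def)
qed

lemma antipodal_count_Un_constant_onD:
  assumes A: "antipodal_count A constant_on G" "G \<inter> A \<noteq> {}" "\<not> G \<subseteq> A"
    and B: "antipodal_count B constant_on G" "G \<inter> B \<noteq> {}" "\<not> G \<subseteq> B"
    and union: "antipodal_count (A \<union> B) constant_on G"
  shows "G \<inter> A = G \<inter> B \<or> G \<inter> A = G \<inter> uminus ` B"
proof -
  obtain k where count_eq: "\<And>d. d \<in> G \<Longrightarrow> antipodal_count (A \<union> B) d = k"
    using union unfolding constant_on_def by blast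
  note antipodal = antipodal_complement[OF A] antipodal_complement[OF B]
  have union_count: "antipodal_count (A \<union> B) d = (if d \<in> A \<longleftrightarrow> d \<in> B then 1 else 2)" if "d \<in> G" for d
    using antipodal[OF that] by (auto simp: antipodal_count_def)
  have "(d \<in> A \<longleftrightarrow> d \<in> B) \<longleftrightarrow> k = 1" if "d \<in> G" for d
    unfolding count_eq[OF that, symmetric] union_count[OF that] by simp
  then have "(\<forall>d\<in>G. d \<in> A \<longleftrightarrow> d \<in> B) \<or> (\<forall>d\<in>G. d \<in> A \<longleftrightarrow> d \<notin> B)"
    by blast
  then have "G \<inter> A = G \<inter> B \<or> G \<inter> A = G - B" by auto
  moreover have "G \<inter> uminus ` B = G - B"
    using antipodal_complement[OF B] mem_uminus_image[of _ B] by blast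
  ultimately show ?thesis by simp
qed

lemma antipodal_count_constant_on_cong:
  assumes "\<And>d. d \<in> G \<Longrightarrow> - d \<in> G" "G \<inter> A = G \<inter> C"
  shows "antipodal_count A constant_on G \<longleftrightarrow> antipodal_count C constant_on G"
proof -
  have "d \<in> A \<longleftrightarrow> d \<in> C" if "d \<in> G" for d using assms(2) that by blast
  then have "antipodal_count A d = antipodal_count C d" if "d \<in> G" for d
    using that assms(1) by (simp add: antipodal_count_def)
  then show ?thesis by (simp add: constant_on_def)
qed

lemma antipodal_count_Un_uminus_constant_on:
  assumes G: "\<And>d. d \<in> G \<Longrightarrow> - d \<in> G"
    and A: "antipodal_count A constant_on G" and reflect: "G \<inter> A = G \<inter> uminus ` B"
  shows "antipodal_count (A \<union> B) constant_on G"
proof -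
  obtain k where count_eq: "\<And>d. d \<in> G \<Longrightarrow> antipodal_count A d = k"
    using A unfolding constant_on_def by blast
  have mem_A_iff: "d \<in> A \<longleftrightarrow> - d \<in> B" if "d \<in> G" for d
    using reflect that mem_uminus_image[of d B] by blast
  have "antipodal_count (A \<union> B) d = (if k = 0 then 0 else 2)" if "d \<in> G" for d
    using count_eq[OF that] mem_A_iff[OF that] mem_A_iff[OF G[OF that]] by (auto simp: antipodal_count_def)
  then show ?thesis unfolding constant_on_def by blast
qed

lemma antipodal_count_Un_constant_on_iff:
  assumes G: "\<And>d. d \<in> G \<Longrightarrow> - d \<in> G"
    and A: "antipodal_count A constant_on G" and B: "antipodal_count B constant_on G"
  shows "antipodal_count (A \<union> B) constant_on G \<longleftrightarrow>
    G \<inter> A = {} \<or> G \<inter> B = {} \<or> G \<subseteq> A \<or> G \<subseteq> B \<or> G \<inter> A = G \<inter> B \<or> G \<inter> A = G \<inter> uminus ` B"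
    (is "_ \<longleftrightarrow> ?cases")
proof
  assume "antipodal_count (A \<union> B) constant_on G"
  then show ?cases using antipodal_count_Un_constant_onD[OF A _ _ B] by blast
next
  assume ?cases
  then consider "G \<inter> (A \<union> B) = G \<inter> A" | "G \<inter> (A \<union> B) = G \<inter> B" | "G \<inter> (A \<union> B) = G \<inter> UNIV"
    | "G \<inter> A = G \<inter> uminus ` B" by blast
  then show "antipodal_count (A \<union> B) constant_on G"
  proof cases
    case 1
    then show ?thesis using antipodal_count_constant_on_cong[OF G] A by blast
  next
    case 2
    then show ?thesis using antipodal_count_constant_on_cong[OF G] B by blast
  next
    case 3
    moreover have "antipodal_count UNIV constant_on G"
      by (simp add: constant_on_def antipodal_count_def)
    ultimately show ?thesis using antipodal_count_constant_on_cong[OF G] by blast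
  next
    case 4
    then show ?thesis using antipodal_count_Un_uminus_constant_on[OF G A] by blast
  qed
qed

subsection \<open>Minkowski sums\<close>

lemma polytope_minkowski_sum:
  assumes "polytope P" "polytope Q"
  shows "polytope (minkowski_sum P Q)"
proof -
  have "minkowski_sum P Q = (\<lambda>(x, y). x + y) ` (P \<times> Q)" by (auto simp: minkowski_sum_def)
  moreover have "linear (\<lambda>(x, y). x + y :: R3)"
    by (rule linearI) (auto simp: algebra_simps)
  ultimately show ?thesis using polytope_linear_image polytope_Times assms by metis
qed

lemma minkowski_sum_eq_empty_iff: "minkowski_sum P Q = {} \<longleftrightarrow> P = {} \<or> Q = {}"
  by (auto simp: minkowski_sum_def)

lemma minkowski_sum_commute: "minkowski_sum P Q = minkowski_sum Q P"
  by (auto simp: minkowski_sum_def) (metis add.commute)+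

lemma minkowski_sumI: "x \<in> P \<Longrightarrow> y \<in> Q \<Longrightarrow> x + y \<in> minkowski_sum P Q"
  by (auto simp: minkowski_sum_def)

lemma support_face_minkowski_sum:
  "support_face (minkowski_sum P Q) d = minkowski_sum (support_face P d) (support_face Q d)"
proof (intro equalityI subsetI)
  fix z assume "z \<in> support_face (minkowski_sum P Q) d"
  then obtain x y where z: "z = x + y" "x \<in> P" "y \<in> Q"
    and max: "\<And>x' y'. x' \<in> P \<Longrightarrow> y' \<in> Q \<Longrightarrow> d \<bullet> (x' + y') \<le> d \<bullet> (x + y)"
    unfolding support_face_def minkowski_sum_def by blast
  have "x \<in> support_face P d" using max[OF _ z(3)] z by (simp add: support_face_def inner_add_right)
  moreover have "y \<in> support_face Q d" using max[OF z(2)] z by (simp add: support_face_def inner_add_right)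
  ultimately show "z \<in> minkowski_sum (support_face P d) (support_face Q d)"
    unfolding z(1) by (rule minkowski_sumI)
next
  fix z assume "z \<in> minkowski_sum (support_face P d) (support_face Q d)"
  then obtain x y where z: "z = x + y" "x \<in> support_face P d" "y \<in> support_face Q d"
    by (auto simp: minkowski_sum_def)
  have "d \<bullet> (x' + y') \<le> d \<bullet> (x + y)" if "x' \<in> P" "y' \<in> Q" for x' y'
    using z that by (simp add: support_face_def inner_add_right add_mono)
  then show "z \<in> support_face (minkowski_sum P Q) d"
    using z unfolding support_face_def minkowski_sum_def by fastforce
qed

lemma collinear_minkowski_sumD:
  assumes "collinear (minkowski_sum S T)" "T \<noteq> {}"
  shows "collinear S"
proof -
  obtain t where t: "t \<in> T" using assms(2) by blast
  obtain e where e: "\<And>x y. x \<in> minkowski_sum S T \<Longrightarrow> y \<in> minkowski_sum S T \<Longrightarrow> x - y \<in> span {e}"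
    using assms(1) unfolding collinear_iff_span by blast
  have "x - y \<in> span {e}" if "x \<in> S" "y \<in> S" for x y
    using e[OF minkowski_sumI[OF that(1) t] minkowski_sumI[OF that(2) t]] by simp
  then show ?thesis unfolding collinear_iff_span by blast
qed

lemma generic_dir_minkowski_sumD:
  assumes "polytope Q" "Q \<noteq> {}" "generic_dir (minkowski_sum P Q) d"
  shows "generic_dir P d"
  using assms collinear_minkowski_sumD support_face_nonempty[OF polytope_imp_compact]
  unfolding generic_dir_def support_face_minkowski_sum by blast

lemma has_chord_minkowski_sum_left:
  assumes "has_chord S u" "T \<noteq> {}"
  shows "has_chord (minkowski_sum S T) u"
proof -
  obtain x y where xy: "x \<in> S" "y \<in> S" "x \<noteq> y" "x - y \<in> span {u}" using assms(1) by (rule has_chordE)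
  obtain t where t: "t \<in> T" using assms(2) by blast
  have "(x + t) - (y + t) \<in> span {u}" using xy(4) by simp
  then show ?thesis
    using xy by (intro has_chordI[OF minkowski_sumI[OF xy(1) t] minkowski_sumI[OF xy(2) t]]) simp_all
qed

lemma has_chord_minkowski_sum:
  assumes "collinear (minkowski_sum S T)" "S \<noteq> {}" "T \<noteq> {}"
  shows "has_chord (minkowski_sum S T) u \<longleftrightarrow> has_chord S u \<or> has_chord T u"
proof
  assume chord: "has_chord (minkowski_sum S T) u"
  then obtain a b a' b' where ab: "a \<in> S" "a' \<in> S" "b \<in> T" "b' \<in> T" "a + b \<noteq> a' + b'"
    unfolding has_chord_def minkowski_sum_def by blast
  have "(a + b) - (a' + b) \<in> span {u}" "(a + b) - (a + b') \<in> span {u}"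
    using ab by (intro collinear_has_chord[OF assms(1) chord] minkowski_sumI; simp)+
  then have "a - a' \<in> span {u}" "b - b' \<in> span {u}" by simp_all
  then show "has_chord S u \<or> has_chord T u" using ab has_chordI by metis
next
  assume "has_chord S u \<or> has_chord T u"
  then show "has_chord (minkowski_sum S T) u"
    using has_chord_minkowski_sum_left assms(2,3) minkowski_sum_commute by metis
qed

lemma aggregated_cone_minkowski_sum:
  assumes P: "polytope P" "P \<noteq> {}" and Q: "polytope Q" "Q \<noteq> {}" and u: "u \<noteq> 0"
  shows "aggregated_cone (minkowski_sum P Q) u = aggregated_cone P u \<union> aggregated_cone Q u"
proof -
  let ?R = "minkowski_sum P Q"
  let ?G = "generic_normals ?R u"
  have R: "polytope ?R" "?R \<noteq> {}"
    using P Q by (simp_all add: polytope_minkowski_sum minkowski_sum_eq_empty_iff)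
  have "d \<in> aggregated_cone ?R u \<longleftrightarrow> d \<in> aggregated_cone P u \<union> aggregated_cone Q u" if "d \<in> ?G" for d
  proof -
    have "generic_dir ?R d" using that by (simp add: mem_generic_normals)
    then have "collinear (support_face ?R d)" "collinear (support_face P d)" "collinear (support_face Q d)"
      using generic_dir_minkowski_sumD[OF Q, of P d] generic_dir_minkowski_sumD[OF P, of Q d]
      by (auto simp: generic_dir_def minkowski_sum_commute[of Q P])
    then show ?thesis
      using aggregated_cone_iff_has_chord[OF R u] aggregated_cone_iff_has_chord[OF P u]
        aggregated_cone_iff_has_chord[OF Q u] has_chord_minkowski_sum
        support_face_nonempty[OF polytope_imp_compact[OF P(1)] P(2)]
        support_face_nonempty[OF polytope_imp_compact[OF Q(1)] Q(2)]
      unfolding support_face_minkowski_sum by auto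
  qed
  then have "aggregated_cone ?R u \<inter> ?G = aggregated_cone P u \<inter> ?G \<union> aggregated_cone Q u \<inter> ?G" by blast
  then have "closure (aggregated_cone ?R u \<inter> ?G) =
      closure (aggregated_cone P u \<inter> ?G) \<union> closure (aggregated_cone Q u \<inter> ?G)"
    by simp
  then show ?thesis by (simp add: closure_aggregated_cone_generic P(1) Q(1) R(1))
qed

lemma edge_count_eq_antipodal_count:
  assumes "polytope P" "P \<noteq> {}" "u \<noteq> 0" "generic_dir P d"
  shows "edge_count P u d = antipodal_count (aggregated_cone P u) d"
  using assms(4) aggregated_cone_iff_has_chord[OF assms(1-3)]
  by (simp add: edge_count_def antipodal_count_def generic_dir_def)

lemma antipodal_count_aggregated_cone_constant:
  assumes "polytope P" "P \<noteq> {}" "u \<noteq> 0" "edge_count P u constant_on generic_normals P u"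
    and "G \<subseteq> generic_normals P u"
  shows "antipodal_count (aggregated_cone P u) constant_on G"
proof (rule constant_onE)
  show "edge_count P u constant_on G" using assms(4,5) by (rule constant_on_subset)
  show "edge_count P u d = antipodal_count (aggregated_cone P u) d" if "d \<in> G" for d
    using that assms(5) by (intro edge_count_eq_antipodal_count assms) (auto simp: mem_generic_normals)
qed

lemma closure_uminus:
  fixes S :: "'a::real_normed_vector set"
  shows "closure (uminus ` S) = uminus ` closure S"
proof -
  have "(*\<^sub>R) (- 1) = (uminus :: 'a \<Rightarrow> 'a)" by (simp add: fun_eq_iff)
  then show ?thesis using closure_scaleR[of "- 1" S] by simp
qed

lemma aggregated_cone_eq_iff_generic:
  fixes P Q R :: "R3 set" and u :: R3
  defines "G \<equiv> generic_normals R u" and "A \<equiv> aggregated_cone P u" and "B \<equiv> aggregated_cone Q u"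
  assumes "polytope P" "polytope Q" "polytope R" "u \<noteq> 0"
  shows "G \<inter> A = {} \<longleftrightarrow> A = {}" "G \<subseteq> A \<longleftrightarrow> A = orth_plane u"
    and "G \<inter> A = G \<inter> B \<longleftrightarrow> A = B" "G \<inter> A = G \<inter> uminus ` B \<longleftrightarrow> A = uminus ` B"
proof -
  have closure_A: "closure (A \<inter> G) = A" and closure_B: "closure (B \<inter> G) = B"
    using assms by (simp_all add: closure_aggregated_cone_generic)
  have "uminus ` B \<inter> G = uminus ` (B \<inter> G)"
    using minus_mem_generic_normals unfolding G_def by force
  then have closure_uminus_B: "closure (uminus ` B \<inter> G) = uminus ` B"
    using closure_B by (simp add: closure_uminus)
  have plane: "orth_plane u \<inter> G = G" by (auto simp: G_def generic_normals_def)
  then have closure_plane: "closure (orth_plane u \<inter> G) = orth_plane u"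
    using assms by (simp add: closure_generic_normals)
  have determined: "G \<inter> X = G \<inter> Y \<longleftrightarrow> X = Y" if "closure (X \<inter> G) = X" "closure (Y \<inter> G) = Y" for X Y
    using that by (metis Int_commute)
  show "G \<inter> A = {} \<longleftrightarrow> A = {}" using determined[OF closure_A, of "{}"] by simp
  show "G \<subseteq> A \<longleftrightarrow> A = orth_plane u" using determined[OF closure_A closure_plane] plane by auto
  show "G \<inter> A = G \<inter> B \<longleftrightarrow> A = B" by (rule determined[OF closure_A closure_B])
  show "G \<inter> A = G \<inter> uminus ` B \<longleftrightarrow> A = uminus ` B" by (rule determined[OF closure_A closure_uminus_B])
qed

lemma edge_count_minkowski_sum_constant_iff:
  assumes P: "polytope P" "P \<noteq> {}" "edge_count P u constant_on generic_normals P u"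
    and Q: "polytope Q" "Q \<noteq> {}" "edge_count Q u constant_on generic_normals Q u"
    and u: "normalized u"
  shows "edge_count (minkowski_sum P Q) u constant_on generic_normals (minkowski_sum P Q) u \<longleftrightarrow>
    (edge_direction P u \<and> edge_direction Q u \<longrightarrow>
       aggregated_cone P u = orth_plane u \<or> aggregated_cone Q u = orth_plane u \<or>
       aggregated_cone P u = aggregated_cone Q u \<or> aggregated_cone P u = uminus ` aggregated_cone Q u)"
proof -
  let ?R = "minkowski_sum P Q" and ?A = "aggregated_cone P u" and ?B = "aggregated_cone Q u"
  let ?G = "generic_normals ?R u"
  note u_neq_0 = normalized_neq_0[OF u]
  have R: "polytope ?R" "?R \<noteq> {}"
    using P Q by (simp_all add: polytope_minkowski_sum minkowski_sum_eq_empty_iff)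
  have "?G \<subseteq> generic_normals P u" "?G \<subseteq> generic_normals Q u"
    using generic_dir_minkowski_sumD[OF Q(1,2), of P] generic_dir_minkowski_sumD[OF P(1,2), of Q]
    by (auto simp: mem_generic_normals minkowski_sum_commute[of Q P])
  then have counts: "antipodal_count ?A constant_on ?G" "antipodal_count ?B constant_on ?G"
    using antipodal_count_aggregated_cone_constant P Q u_neq_0 by blast+
  have "edge_count ?R u constant_on ?G \<longleftrightarrow> antipodal_count (?A \<union> ?B) constant_on ?G"
    unfolding aggregated_cone_minkowski_sum[OF P(1,2) Q(1,2) u_neq_0, symmetric] constant_on_def
    using edge_count_eq_antipodal_count[OF R u_neq_0] by (simp add: mem_generic_normals)
  also have "\<dots> \<longleftrightarrow> ?G \<inter> ?A = {} \<or> ?G \<inter> ?B = {} \<or> ?G \<subseteq> ?A \<or> ?G \<subseteq> ?B \<or>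
      ?G \<inter> ?A = ?G \<inter> ?B \<or> ?G \<inter> ?A = ?G \<inter> uminus ` ?B"
    by (intro antipodal_count_Un_constant_on_iff minus_mem_generic_normals counts)
  also have "\<dots> \<longleftrightarrow> ?A = {} \<or> ?B = {} \<or> ?A = orth_plane u \<or> ?B = orth_plane u \<or> ?A = ?B \<or> ?A = uminus ` ?B"
    by (simp only: aggregated_cone_eq_iff_generic[OF P(1) Q(1) R(1) u_neq_0]
        aggregated_cone_eq_iff_generic(1,2)[OF Q(1) P(1) R(1) u_neq_0])
  finally show ?thesis
    using edge_direction_iff_aggregated_cone[OF P(1,2) u] edge_direction_iff_aggregated_cone[OF Q(1,2) u]
    by blast
qed

theorem theorem4p3:
  fixes P Q :: "(real ^ 3) set"
  assumes "admissible_summand P" and "admissible_summand Q"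
    and "aff_dim (minkowski_sum P Q) = 3"
  shows "equiprojective (minkowski_sum P Q) \<longleftrightarrow>
    (\<forall>u. edge_direction P u \<and> edge_direction Q u \<longrightarrow>
       (aggregated_cone P u = orth_plane u \<or> aggregated_cone Q u = orth_plane u) \<or>
       (aggregated_cone P u = aggregated_cone Q u \<or>
        aggregated_cone P u = uminus ` aggregated_cone Q u))"
proof -
  note P = admissible_summandD[OF assms(1)] and Q = admissible_summandD[OF assms(2)]
  interpret solid_polytope "minkowski_sum P Q"
    using polytope_minkowski_sum[OF P(1) Q(1)] assms(3) by unfold_locales
  have "equiprojective (minkowski_sum P Q) \<longleftrightarrow>
    (\<forall>u. normalized u \<longrightarrow>
      edge_count (minkowski_sum P Q) u constant_on generic_normals (minkowski_sum P Q) u)"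
    by (rule equiprojective_iff_edge_count_constant)
  also have "\<dots> \<longleftrightarrow> (\<forall>u. normalized u \<longrightarrow> edge_direction P u \<and> edge_direction Q u \<longrightarrow>
      aggregated_cone P u = orth_plane u \<or> aggregated_cone Q u = orth_plane u \<or>
      aggregated_cone P u = aggregated_cone Q u \<or> aggregated_cone P u = uminus ` aggregated_cone Q u)"
    using edge_count_minkowski_sum_constant_iff[OF P admissible_summand_edge_count_constant[OF assms(1)]
        Q admissible_summand_edge_count_constant[OF assms(2)]] by simp
  finally show ?thesis using edge_direction_normalized by blast
qed

end
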